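(* Let $m\ge n$ be positive integers, let $\Omega\subset\mathbb{R}^n$ be a connected open set and let $K=\{A_1,A_2,A_3\}\subset\mathbb{M}^{m\times n}$ be a set of matrices with $\operatorname{rank}(A_i-A_j)=n$ for all $i\neq j$. If $B:\Omega\to K$ is a measurable function satisfying $\operatorname{Div}B=0$ in $\mathcal{D}'(\Omega,\mathbb{R}^m)$, then $B$ is constant (almost everywhere in $\Omega$).
   Context: $\mathbb{M}^{m\times n}$ denotes the set of real $m\times n$ matrices. For $B\in L^\infty(\Omega,\mathbb{M}^{m\times n})$, the condition $\operatorname{Div}B=0$ in $\mathcal{D}'(\Omega,\mathbb{R}^m)$ means that every row of $B$ is divergence free in the distributional sense, i.e. for each row $b$ of $B$ (a vector field in $L^\infty(\Omega,\mathbb{R}^n)$) one has $\int_\Omega\langle b(x),\nabla\varphi(x)\rangle\,dx=0$ for every $\varphi\in C_0^\infty(\Omega)$. Measurable functions are identified when they agree almost everywhere. *)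

theory Defs
  imports "HOL-Analysis.Analysis"
begin

definition gradient :: "(real^'n \<Rightarrow> real) \<Rightarrow> real^'n \<Rightarrow> real^'n" where
  "gradient f x = (\<chi> j. frechet_derivative f (at x) (axis j 1))"

primrec C_k :: "nat \<Rightarrow> (real^'n \<Rightarrow> real) \<Rightarrow> bool" where
  "C_k 0 f \<longleftrightarrow> continuous_on UNIV f"
| "C_k (Suc k) f \<longleftrightarrow> f differentiable_on UNIV \<and> (\<forall>j. C_k k (\<lambda>x. gradient f x $ j))"

(* The space of smooth functions with compact support in \<Omega>; its elements are
   represented by their extensions by zero to the whole space. *)
definition test_functions :: "(real^'n) set \<Rightarrow> (real^'n \<Rightarrow> real) set" where
  "test_functions \<Omega> =
    {\<phi>. (\<forall>k. C_k k \<phi>) \<and> compact (closure {x. \<phi> x \<noteq> 0}) \<and> closure {x. \<phi> x \<noteq> 0} \<subseteq> \<Omega>}"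

(* Intended for measurable, essentially bounded B, so that the integrands are integrable. *)
definition distr_Div_zero :: "(real^'n) set \<Rightarrow> (real^'n \<Rightarrow> real^'n^'m) \<Rightarrow> bool" where
  "distr_Div_zero \<Omega> B \<longleftrightarrow>
    (\<forall>i. \<forall>\<phi> \<in> test_functions \<Omega>. (LINT x|lebesgue_on \<Omega>. row i (B x) \<bullet> gradient \<phi> x) = 0)"

end

theory Submission
  imports Defs "HOL-Computational_Algebra.Fundamental_Theorem_Algebra"
begin

text \<open>
  The field is \<open>B = A\<^sub>3 + u P + v Q\<close> with \<open>P = A\<^sub>1 - A\<^sub>3\<close>, \<open>Q = A\<^sub>2 - A\<^sub>3\<close> and the indicators \<open>u\<close>, \<open>v\<close> of the
  disjoint sets where \<open>B = A\<^sub>1\<close> and \<open>B = A\<^sub>2\<close>. Since constant fields are divergence free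
  (\<open>integral_gradient_eq_0\<close>), \<open>Div B = 0\<close> means \<open>P \<nabla>u + Q \<nabla>v = 0\<close> (\<open>phase_equation\<close>). The matrices \<open>P\<close>, \<open>Q\<close>
  and \<open>P - Q\<close> have rank \<open>n\<close>, so a generic \<open>m \<times> n\<close> matrix \<open>S\<close> makes \<open>P\<^sup>T S\<close>, \<open>Q\<^sup>T S\<close> and \<open>(P - Q)\<^sup>T S\<close> all
  invertible. Normalising the first to \<open>1\<close> and putting \<open>T = Q\<^sup>T S\<close>, one gets
  \<open>\<partial>\<^sub>z u + \<partial>\<^bsub>Tz\<^esub> v = 0\<close> for every direction \<open>z\<close>, real or complex, and neither \<open>0\<close> nor \<open>1\<close> is an eigenvalue
  of \<open>T\<close> (\<open>reduction_to_square\<close>).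

  If \<open>T z = l z\<close>, then \<open>f = u + l v\<close> satisfies \<open>\<partial>\<^sub>z f = 0\<close> and takes the three distinct values \<open>0\<close>, \<open>1\<close>, \<open>l\<close>.
  For real \<open>z\<close> such an \<open>f\<close> is constant along lines, for complex \<open>z\<close> it is holomorphic along planes. What
  both cases share is that bounded solutions of \<open>\<partial>\<^sub>z f = 0\<close> are closed under squaring
  (\<open>weak_cderiv_zero_square\<close>). Here \<open>f\<^sup>2 = u + l\<^sup>2 v\<close>, and comparing the equations for \<open>f\<close> and \<open>f\<^sup>2\<close> yields
  \<open>\<partial>\<^sub>z u = \<partial>\<^sub>z v = 0\<close>. The same computation works modulo directions in which both derivatives are
  already known to vanish, hence along chains of generalised eigenvectors, which span
  \<open>\<complex>\<^sup>n\<close> (\<open>eigenvalue_induction\<close>, \<open>weak_cderiv_zero_two_phases\<close>).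

  Thus all distributional derivatives of \<open>u\<close> and \<open>v\<close> vanish. On a small ball each of the two sets is
  therefore null or of full measure (\<open>flat_set_null_or_conull_on_ball\<close>), which means that \<open>B\<close> is almost
  everywhere constant there, and connectedness makes the constant global
  (\<open>locally_ae_constant_imp_ae_constant\<close>). The analysis is done with the Borel measure, for the sake of
  product measures, after replacing the level sets of \<open>B\<close> by almost equal Borel subsets.
\<close>

section \<open>Gradients and smooth functions\<close>

lemma has_derivative_gradient:
  assumes "f differentiable (at x)"
  shows "(f has_derivative (\<lambda>h. gradient f x \<bullet> h)) (at x)"
proof -
  have D: "(f has_derivative frechet_derivative f (at x)) (at x)"
    using assms frechet_derivative_works by blast
  then interpret bounded_linear "frechet_derivative f (at x)"
    by (rule has_derivative_bounded_linear)
  have "frechet_derivative f (at x) h = gradient f x \<bullet> h" for h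
  proof -
    have "frechet_derivative f (at x) h
        = frechet_derivative f (at x) (\<Sum>j\<in>UNIV. h $ j *\<^sub>R axis j 1)"
      using basis_expansion[of h] by (simp add: scalar_mult_eq_scaleR)
    also have "\<dots> = gradient f x \<bullet> h"
      by (simp add: sum scaleR gradient_def inner_vec_def mult.commute)
    finally show ?thesis .
  qed
  then have "frechet_derivative f (at x) = (\<lambda>h. gradient f x \<bullet> h)" by (rule ext)
  with D show ?thesis by simp
qed

lemma gradient_eqI:
  assumes "(f has_derivative (\<lambda>h. g \<bullet> h)) (at x)"
  shows "gradient f x = g"
  using frechet_derivative_at[OF assms, symmetric]
  by (simp add: gradient_def vec_eq_iff inner_axis)

lemma C_k_SucI:
  assumes "\<And>x. (f has_derivative (\<lambda>h. g x \<bullet> h)) (at x)" "\<And>j. C_k k (\<lambda>x. g x $ j)"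
  shows "C_k (Suc k) f"
  using assms(2) gradient_eqI[OF assms(1)] assms(1)
  by (auto simp: differentiable_on_def differentiable_def)

text \<open>
  The recursive clause for \<^term>\<open>C_k (Suc k)\<close> speaks only of the partial derivatives; that the
  classes decrease with \<^term>\<open>k\<close> goes back, through the recursion, to differentiable functions being
  continuous. The product rule below uses it, since it multiplies derivatives by undifferentiated
  factors.
\<close>

lemma C_k_SucD: "C_k (Suc k) f \<Longrightarrow> C_k k f"
proof (induction k arbitrary: f)
  case 0
  then show ?case by (simp add: differentiable_imp_continuous_on)
qed auto

lemma C_k_differentiable: "C_k (Suc k) f \<Longrightarrow> f differentiable (at x)"
  by (simp add: differentiable_on_def)

lemma C_k_const: "C_k k (\<lambda>x. c)"
proof (induction k arbitrary: c)
  case (Suc k)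
  show ?case by (rule C_k_SucI[where g = "\<lambda>x. 0"]) (use Suc in auto)
qed auto

lemma C_k_component: "C_k k (\<lambda>x :: real^'n. x $ i)"
proof (cases k)
  case (Suc l)
  have "((\<lambda>x. x $ i) has_derivative (\<lambda>h. axis i 1 \<bullet> h)) (at x)" for x :: "real^'n"
    by (simp add: inner_axis' bounded_linear_imp_has_derivative bounded_linear_vec_nth)
  then show ?thesis unfolding Suc
    by (rule C_k_SucI) (rule C_k_const)
qed (auto intro!: continuous_intros)

lemma C_k_add: "C_k k f \<Longrightarrow> C_k k g \<Longrightarrow> C_k k (\<lambda>x. f x + g x)"
proof (induction k arbitrary: f g)
  case (Suc k)
  show ?case
  proof (rule C_k_SucI[where g = "\<lambda>x. gradient f x + gradient g x"])
    show "((\<lambda>x. f x + g x) has_derivative (\<lambda>h. (gradient f x + gradient g x) \<bullet> h)) (at x)" for x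
      unfolding inner_add_left
      by (intro has_derivative_add has_derivative_gradient C_k_differentiable[OF Suc.prems(1)]
          C_k_differentiable[OF Suc.prems(2)])
  qed (use Suc in simp)
qed (auto intro!: continuous_intros)

lemma has_derivative_mult_gradient:
  assumes "f differentiable (at x)" "g differentiable (at x)"
  shows "((\<lambda>x. f x * g x) has_derivative
     (\<lambda>h. (f x *\<^sub>R gradient g x + g x *\<^sub>R gradient f x) \<bullet> h)) (at x)"
  by (rule has_derivative_eq_rhs[OF has_derivative_mult[OF has_derivative_gradient[OF assms(1)]
          has_derivative_gradient[OF assms(2)]]])
    (auto simp: inner_add_left algebra_simps)

lemma C_k_mult: "C_k k f \<Longrightarrow> C_k k g \<Longrightarrow> C_k k (\<lambda>x. f x * g x)"
proof (induction k arbitrary: f g)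
  case (Suc k)
  show ?case
  proof (rule C_k_SucI[where g = "\<lambda>x. f x *\<^sub>R gradient g x + g x *\<^sub>R gradient f x"])
    show "((\<lambda>x. f x * g x) has_derivative
        (\<lambda>h. (f x *\<^sub>R gradient g x + g x *\<^sub>R gradient f x) \<bullet> h)) (at x)" for x
      by (intro has_derivative_mult_gradient C_k_differentiable[OF Suc.prems(1)]
          C_k_differentiable[OF Suc.prems(2)])
    have "C_k k f" "C_k k g" using Suc.prems C_k_SucD by blast+
    then show "C_k k (\<lambda>x. (f x *\<^sub>R gradient g x + g x *\<^sub>R gradient f x) $ j)" for j
      using Suc by (simp add: C_k_add)
  qed
qed (auto intro!: continuous_intros)

section \<open>Test functions\<close>

lemma test_functionD:
  assumes "\<phi> \<in> test_functions \<Omega>"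
  shows "C_k k \<phi>" "\<phi> differentiable (at x)" "continuous_on UNIV \<phi>"
    "compact (closure {x. \<phi> x \<noteq> 0})" "closure {x. \<phi> x \<noteq> 0} \<subseteq> \<Omega>"
proof -
  show C: "C_k k \<phi>" for k using assms by (simp add: test_functions_def)
  show "\<phi> differentiable (at x)" by (rule C_k_differentiable[OF C])
  show "continuous_on UNIV \<phi>" using C[of 0] by simp
qed (use assms in \<open>auto simp: test_functions_def\<close>)

lemma test_functions_mono: "S \<subseteq> T \<Longrightarrow> test_functions S \<subseteq> test_functions T"
  by (auto simp: test_functions_def)

text \<open>
  A smooth factor can only shrink the support.
\<close>

lemma test_functions_mult:
  assumes "\<phi> \<in> test_functions \<Omega>" "\<And>k. C_k k \<rho>"
  shows "(\<lambda>x. \<rho> x * \<phi> x) \<in> test_functions \<Omega>"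
proof -
  have sub: "closure {x. \<rho> x * \<phi> x \<noteq> 0} \<subseteq> closure {x. \<phi> x \<noteq> 0}"
    by (intro closure_mono) auto
  have "compact (closure {x. \<rho> x * \<phi> x \<noteq> 0})"
    using test_functionD(4)[OF assms(1)] sub
    by (meson bounded_subset closed_closure compact_eq_bounded_closed)
  then show ?thesis
    using sub test_functionD[OF assms(1)] assms(2) by (auto simp: test_functions_def C_k_mult)
qed

lemma gradient_eq_0_outside_support:
  assumes "x \<notin> closure {x. \<phi> x \<noteq> 0}"
  shows "gradient \<phi> x = 0"
proof (rule gradient_eqI)
  have "((\<lambda>x. 0) has_derivative (\<lambda>h. 0 \<bullet> h)) (at x)" by simp
  then show "(\<phi> has_derivative (\<lambda>h. 0 \<bullet> h)) (at x)"
    by (rule has_derivative_transform_within_open[where s = "- closure {x. \<phi> x \<noteq> 0}"])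
      (use assms closure_subset[of "{x. \<phi> x \<noteq> 0}"] in \<open>auto simp: subset_iff\<close>)
qed

lemma continuous_on_gradient:
  assumes "\<phi> \<in> test_functions \<Omega>"
  shows "continuous_on UNIV (gradient \<phi>)"
proof -
  have "continuous_on UNIV (\<lambda>x. gradient \<phi> x $ j)" for j
    using test_functionD(1)[OF assms, of "Suc 0"] by simp
  then have "continuous_on UNIV (\<lambda>x. \<chi> j. gradient \<phi> x $ j)"
    by (intro continuous_on_vec_lambda)
  then show ?thesis by (simp add: vec_nth_inverse)
qed

lemma continuous_compact_support_bounded:
  fixes f :: "'a::metric_space \<Rightarrow> 'b::real_normed_vector"
  assumes "continuous_on UNIV f" "compact K" "\<And>x. x \<notin> K \<Longrightarrow> f x = 0"
  obtains M where "M \<ge> 0" "\<And>x. norm (f x) \<le> M"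
proof -
  have "bounded (f ` K)"
    by (intro compact_imp_bounded compact_continuous_image continuous_on_subset[OF assms(1)]
        assms(2)) auto
  then obtain M where "\<And>x. x \<in> K \<Longrightarrow> norm (f x) \<le> M"
    by (auto simp: bounded_iff)
  then have "norm (f x) \<le> max M 0" for x
    by (cases "x \<in> K") (use assms(3) in \<open>auto intro: max.coboundedI1\<close>)
  then show ?thesis by (intro that[of "max M 0"]) auto
qed

lemma gradient_bounded:
  assumes "\<phi> \<in> test_functions \<Omega>"
  obtains M where "M \<ge> 0" "\<And>x. norm (gradient \<phi> x) \<le> M"
proof (rule continuous_compact_support_bounded[OF continuous_on_gradient[OF assms]
      test_functionD(4)[OF assms]])
qed (use that gradient_eq_0_outside_support in blast)+

lemma test_function_bounded:
  assumes "\<phi> \<in> test_functions \<Omega>"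
  obtains M where "M \<ge> 0" "\<And>x. \<bar>\<phi> x\<bar> \<le> M"
proof (rule continuous_compact_support_bounded[OF test_functionD(3)[OF assms]
      test_functionD(4)[OF assms]])
  show "x \<notin> closure {x. \<phi> x \<noteq> 0} \<Longrightarrow> \<phi> x = 0" for x
    using closure_subset[of "{x. \<phi> x \<noteq> 0}"] by auto
qed (use that in simp)

lemma gradient_mult:
  assumes "f differentiable (at x)" "g differentiable (at x)"
  shows "gradient (\<lambda>x. f x * g x) x = f x *\<^sub>R gradient g x + g x *\<^sub>R gradient f x"
  by (rule gradient_eqI[OF has_derivative_mult_gradient[OF assms]])

lemma gradient_translate:
  assumes "f differentiable (at (x - c))"
  shows "gradient (\<lambda>x. f (x - c)) x = gradient f (x - c)"
proof (rule gradient_eqI)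
  have "((\<lambda>x. x - c) has_derivative (\<lambda>h. h)) (at x)"
    by (auto intro!: derivative_eq_intros)
  from has_derivative_compose[OF this has_derivative_gradient[OF assms]]
  show "((\<lambda>x. f (x - c)) has_derivative (\<lambda>h. gradient f (x - c) \<bullet> h)) (at x)" .
qed

lemma gradient_reflect:
  assumes "f differentiable (at (y - x))"
  shows "gradient (\<lambda>x. f (y - x)) x = - gradient f (y - x)"
proof (rule gradient_eqI)
  have "((\<lambda>x. y - x) has_derivative (\<lambda>h. - h)) (at x)"
    by (auto intro!: derivative_eq_intros)
  from has_derivative_compose[OF this has_derivative_gradient[OF assms]]
  show "((\<lambda>x. f (y - x)) has_derivative (\<lambda>h. (- gradient f (y - x)) \<bullet> h)) (at x)"
    by simp
qed

section \<open>Mollifiers\<close>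

text \<open>
  The classical functions \<open>exp (-1/t) / t^m\<close>, extended by \<open>0\<close> to \<open>t \<le> 0\<close>. The parameter \<^term>\<open>m\<close>
  makes the family closed under differentiation up to linear combinations, so that one induction
  settles smoothness for all members at once.
\<close>

definition flat_exp :: "nat \<Rightarrow> real \<Rightarrow> real" where
  "flat_exp m t = (if t \<le> 0 then 0 else exp (- 1 / t) / t ^ m)"

text \<open>
  With \<open>s = 1/t\<close> this is the statement that the exponential outgrows every power.
\<close>

lemma flat_exp_tendsto_0: "(flat_exp m \<longlongrightarrow> 0) (at 0)"
proof -
  have "((\<lambda>t. exp (- 1 / t) / t ^ m) \<longlongrightarrow> 0) (at_right (0::real))"
  proof -
    have "((\<lambda>s. s ^ m / exp s) \<longlongrightarrow> 0) (at_top :: real filter)"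
      by (rule tendsto_power_div_exp_0)
    then have "((\<lambda>t. inverse t ^ m / exp (inverse t)) \<longlongrightarrow> 0) (at_right (0::real))"
      by (rule filterlim_compose[OF _ filterlim_inverse_at_top_right])
    then show ?thesis
      by (simp add: exp_minus field_simps)
  qed
  then have "(flat_exp m \<longlongrightarrow> 0) (at_right 0)"
    by (rule tendsto_cong[THEN iffD1, rotated])
      (auto simp: flat_exp_def eventually_at_right_less eventually_at_topological
        intro!: exI[of _ UNIV])
  moreover have "(flat_exp m \<longlongrightarrow> 0) (at_left 0)"
    by (rule tendsto_eventually) (auto simp: flat_exp_def eventually_at_topological intro!: exI[of _ UNIV])
  ultimately show ?thesis by (simp add: filterlim_split_at)
qed

text \<open>
  At the origin the difference quotient of the member with index \<^term>\<open>m\<close> is the member with index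
  \<open>m + 1\<close>, so differentiability there is again the limit at \<open>0\<close>.
\<close>

lemma flat_exp_has_derivative:
  "(flat_exp m has_real_derivative (flat_exp (m + 2) t - real m * flat_exp (m + 1) t)) (at t)"
proof (cases t "0::real" rule: linorder_cases)
  case less
  have "((\<lambda>t. 0) has_real_derivative 0) (at t)" by simp
  then have "(flat_exp m has_real_derivative 0) (at t)"
    by (rule has_field_derivative_transform_within_open[where S = "{..<0}"])
      (use less in \<open>auto simp: flat_exp_def\<close>)
  then show ?thesis using less by (simp add: flat_exp_def)
next
  case equal
  have "((\<lambda>h. flat_exp m h / h) \<longlongrightarrow> 0) (at 0)"
    by (rule tendsto_cong[THEN iffD1, OF _ flat_exp_tendsto_0[of "Suc m"]])
      (auto simp: flat_exp_def eventually_at_topological intro!: exI[of _ UNIV])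
  then show ?thesis using equal
    by (simp add: flat_exp_def[of _ 0] DERIV_def)
next
  case greater
  have "((\<lambda>t. exp (- 1 / t) / t ^ m) has_real_derivative
     (exp (- 1 / t) / t ^ (m + 2) - real m * (exp (- 1 / t) / t ^ (m + 1)))) (at t)"
  proof (cases m)
    case 0
    then show ?thesis using greater
      by (auto intro!: derivative_eq_intros simp: field_simps power2_eq_square)
  next
    case (Suc k)
    have "k = 0 \<or> t ^ k = t * t ^ (k - Suc 0)" by (cases k) auto
    then show ?thesis using greater unfolding Suc
      by (auto intro!: derivative_eq_intros simp: field_simps power2_eq_square power_add)
  qed
  then have "(flat_exp m has_real_derivative
     (exp (- 1 / t) / t ^ (m + 2) - real m * (exp (- 1 / t) / t ^ (m + 1)))) (at t)"
    by (rule has_field_derivative_transform_within_open[where S = "{0<..}"])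
      (use greater in \<open>auto simp: flat_exp_def\<close>)
  then show ?thesis using greater by (simp add: flat_exp_def)
qed

lemma C_k_flat_exp: "C_k k (\<lambda>x. flat_exp m (s - (x - c) \<bullet> (x - c)))"
proof (induction k arbitrary: m)
  case 0
  have "continuous_on UNIV (flat_exp m)"
    using DERIV_isCont[OF flat_exp_has_derivative] continuous_at_imp_continuous_on by blast
  then have "continuous_on UNIV (flat_exp m \<circ> (\<lambda>x. s - (x - c) \<bullet> (x - c)))"
    by (intro continuous_on_compose continuous_intros) (auto elim: continuous_on_subset)
  then show ?case by (simp add: o_def)
next
  case (Suc k)
  let ?q = "\<lambda>x. s - (x - c) \<bullet> (x - c)"
  let ?d = "\<lambda>x. flat_exp (m + 2) (?q x) + (- real m) * flat_exp (m + 1) (?q x)"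
  show ?case
  proof (rule C_k_SucI[where g = "\<lambda>x. (?d x * (- 2)) *\<^sub>R (x - c)"])
    fix x
    have q: "(?q has_derivative (\<lambda>h. (- 2 *\<^sub>R (x - c)) \<bullet> h)) (at x)"
      by (auto intro!: derivative_eq_intros simp: inner_commute)
    have "(flat_exp m has_derivative (*) (?d x)) (at (?q x))"
      using flat_exp_has_derivative[of m "?q x"] by (simp add: has_field_derivative_def)
    from has_derivative_compose[OF q this]
    show "((\<lambda>x. flat_exp m (?q x)) has_derivative
        (\<lambda>h. ((?d x * (- 2)) *\<^sub>R (x - c)) \<bullet> h)) (at x)"
      by (simp add: algebra_simps)
  next
    fix j
    have "C_k k (\<lambda>x. (?d x * (- 2)) * (x $ j + (- (c $ j))))"
      by (intro C_k_mult C_k_add C_k_const C_k_component Suc)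
    then show "C_k k (\<lambda>x. ((?d x * (- 2)) *\<^sub>R (x - c)) $ j)" by simp
  qed
qed

text \<open>
  The profile is \<^term>\<open>flat_exp 0\<close> applied to a quadratic polynomial, rather than to the norm, because
  the polynomial is smooth also at the centre.
\<close>

definition bump :: "real \<Rightarrow> real^'n \<Rightarrow> real" where
  "bump \<epsilon> x = flat_exp 0 (\<epsilon>\<^sup>2 - x \<bullet> x)"

definition mollifier :: "real \<Rightarrow> real^'n \<Rightarrow> real" where
  "mollifier \<epsilon> x = bump \<epsilon> x / (LINT y|lborel. bump \<epsilon> (y :: real^'n))"

lemma flat_exp_0_pos_iff: "0 < flat_exp 0 t \<longleftrightarrow> 0 < t"
  by (auto simp: flat_exp_def)

lemma flat_exp_0_bounds: "0 \<le> flat_exp 0 t" "flat_exp 0 t \<le> 1"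
  by (auto simp: flat_exp_def)

lemma bump_eq_0:
  assumes "\<epsilon> \<le> norm x" "0 < \<epsilon>"
  shows "bump \<epsilon> x = 0"
proof -
  have "\<epsilon>\<^sup>2 \<le> (norm x)\<^sup>2" using assms by (intro power_mono) auto
  then show ?thesis by (simp add: bump_def flat_exp_def power2_norm_eq_inner)
qed

lemma C_k_bump: "C_k k (\<lambda>x. bump \<epsilon> (x - c))"
  unfolding bump_def by (rule C_k_flat_exp)

lemma C_k_bump_0: "C_k k (bump \<epsilon>)"
  using C_k_bump[of k \<epsilon> 0] by simp

lemma bump_measurable [measurable]: "bump \<epsilon> \<in> borel_measurable borel"
  using C_k_bump_0[of 0] by (intro borel_measurable_continuous_onI) simp

lemma bump_integrable:
  assumes "0 < \<epsilon>"
  shows "integrable lborel (bump \<epsilon> :: real^'n \<Rightarrow> real)"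
proof (rule Bochner_Integration.integrable_bound)
  show "integrable lborel (indicator (ball (0::real^'n) \<epsilon>) :: _ \<Rightarrow> real)"
    using emeasure_bounded_finite[of "ball (0::real^'n) \<epsilon>"]
    by (intro integrable_real_indicator) auto
  show "AE x in lborel. norm (bump \<epsilon> x) \<le> norm (indicat_real (ball (0::real^'n) \<epsilon>) x)"
  proof (rule AE_I2)
    fix x :: "real^'n"
    show "norm (bump \<epsilon> x) \<le> norm (indicat_real (ball 0 \<epsilon>) x)"
      using bump_eq_0[OF _ assms, of x] flat_exp_0_bounds
      by (cases "norm x < \<epsilon>") (auto simp: bump_def indicator_def)
  qed
qed simp

lemma bump_integral_pos:
  assumes "0 < \<epsilon>"
  shows "0 < (LINT x|lborel. bump \<epsilon> (x :: real^'n))"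
proof (rule ccontr)
  assume "\<not> ?thesis"
  then have "(LINT x|lborel. bump \<epsilon> (x :: real^'n)) = 0"
    by (simp add: antisym flat_exp_0_bounds bump_def not_less)
  moreover have "AE x in lborel. 0 \<le> bump \<epsilon> (x :: real^'n)"
    by (simp add: bump_def flat_exp_0_bounds)
  ultimately have "AE x in lborel. bump \<epsilon> (x :: real^'n) = 0"
    using integral_nonneg_eq_0_iff_AE[OF bump_integrable[OF assms]] by blast
  moreover have "bump \<epsilon> x \<noteq> 0" if "x \<in> ball 0 \<epsilon>" for x :: "real^'n"
  proof -
    have "(norm x)\<^sup>2 < \<epsilon>\<^sup>2" using that assms by (intro power_strict_mono) auto
    then show ?thesis
      using flat_exp_0_pos_iff[of "\<epsilon>\<^sup>2 - x \<bullet> x"] by (auto simp: bump_def power2_norm_eq_inner)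
  qed
  ultimately have "AE x in lborel. x \<notin> ball (0 :: real^'n) \<epsilon>"
    by (auto elim: eventually_mono)
  then have "ball (0::real^'n) \<epsilon> \<in> null_sets lborel"
    by (simp add: AE_iff_null_sets)
  then have "negligible (ball (0::real^'n) \<epsilon>)"
    by (simp add: negligible_iff_null_sets null_sets_completionI)
  then show False
    using assms open_not_negligible[of "ball (0::real^'n) \<epsilon>"] by auto
qed

lemma mollifier_nonneg: "0 < \<epsilon> \<Longrightarrow> 0 \<le> mollifier \<epsilon> x"
  using bump_integral_pos[of \<epsilon>, where 'n = 'a] by (simp add: mollifier_def bump_def flat_exp_0_bounds)

lemma mollifier_eq_0: "\<epsilon> \<le> norm x \<Longrightarrow> 0 < \<epsilon> \<Longrightarrow> mollifier \<epsilon> x = 0"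
  by (simp add: mollifier_def bump_eq_0)

lemma mollifier_minus: "mollifier \<epsilon> (- x) = mollifier \<epsilon> x"
  by (simp add: mollifier_def bump_def)

lemma mollifier_measurable [measurable]: "mollifier \<epsilon> \<in> borel_measurable borel"
  unfolding mollifier_def[abs_def] by measurable

lemma mollifier_integrable: "0 < \<epsilon> \<Longrightarrow> integrable lborel (mollifier \<epsilon>)"
  unfolding mollifier_def[abs_def] by (intro integrable_divide_zero bump_integrable)

lemma mollifier_integral:
  "0 < \<epsilon> \<Longrightarrow> (LINT x|lborel. mollifier \<epsilon> (x :: real^'n)) = 1"
  using bump_integral_pos[of \<epsilon>, where 'n = 'n] by (simp add: mollifier_def)

lemma C_k_mollifier: "C_k k (\<lambda>x. mollifier \<epsilon> (x - c))"
  using C_k_mult[OF C_k_bump C_k_const[of k "1 / (LINT y|lborel. bump \<epsilon> y)"]]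
  by (simp add: mollifier_def)

lemma mollifier_test_function:
  assumes "0 < \<epsilon>" "cball c \<epsilon> \<subseteq> \<Omega>"
  shows "(\<lambda>x. mollifier \<epsilon> (x - c)) \<in> test_functions \<Omega>"
proof -
  have "{x. mollifier \<epsilon> (x - c) \<noteq> 0} \<subseteq> cball c \<epsilon>"
    using mollifier_eq_0[OF _ assms(1)]
    by (force simp: dist_norm norm_minus_commute not_le)
  then have sub: "closure {x. mollifier \<epsilon> (x - c) \<noteq> 0} \<subseteq> cball c \<epsilon>"
    by (intro closure_minimal) auto
  then have "compact (closure {x. mollifier \<epsilon> (x - c) \<noteq> 0})"
    by (meson bounded_cball bounded_subset closed_closure compact_eq_bounded_closed)
  then show ?thesis
    using sub assms C_k_mollifier by (auto simp: test_functions_def)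
qed

lemma mollifier_test_function_UNIV:
  assumes "0 < \<epsilon>"
  shows "mollifier \<epsilon> \<in> test_functions UNIV"
  using mollifier_test_function[OF assms, of 0 UNIV] by simp

section \<open>Continuity of translations in the mean\<close>

text \<open>
  Lebesgue measure on a Euclidean space is its own image under a translation.
\<close>

lemma integrable_lborel_translate:
  fixes f :: "'a::euclidean_space \<Rightarrow> 'b::{banach, second_countable_topology}"
  assumes "integrable lborel f"
  shows "integrable lborel (\<lambda>x. f (h + x))"
proof -
  have [measurable]: "f \<in> borel_measurable borel"
    using assms borel_measurable_integrable by simp
  have "integrable (distr lborel borel ((+) h)) f"
    unfolding lborel_distr_plus by (rule assms)
  then show ?thesis by (subst (asm) integrable_distr_eq) auto
qed

lemma integral_lborel_translate:
  fixes f :: "'a::euclidean_space \<Rightarrow> 'b::{banach, second_countable_topology}"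
  assumes [measurable]: "f \<in> borel_measurable borel"
  shows "(LINT x|lborel. f (h + x)) = (LINT x|lborel. f x)"
proof -
  have "(LINT x|lborel. f x) = (LINT x|distr lborel borel ((+) h). f x)"
    unfolding lborel_distr_plus ..
  also have "\<dots> = (LINT x|lborel. f (h + x))" by (rule integral_distr) auto
  finally show ?thesis ..
qed

definition L1_translation_continuous ::
    "('a::euclidean_space \<Rightarrow> 'b::{banach, second_countable_topology}) \<Rightarrow> bool" where
  "L1_translation_continuous f \<longleftrightarrow>
    (\<forall>e>0. \<exists>d>0. \<forall>h. norm h < d \<longrightarrow> (LINT x|lborel. norm (f (h + x) - f x)) < e)"

text \<open>
  Translations are isometries of \<open>L\<^sup>1\<close>, so an \<open>L\<^sup>1\<close>-approximation of \<^term>\<open>f\<close> is translated as accurately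
  as it approximates: the usual three-epsilon argument.
\<close>

lemma L1_translation_continuous_approx:
  fixes f :: "'a::euclidean_space \<Rightarrow> 'b::{banach, second_countable_topology}"
  assumes f: "integrable lborel f"
    and appr: "\<And>e. e > 0 \<Longrightarrow> \<exists>g. integrable lborel g \<and> L1_translation_continuous g \<and>
      (LINT x|lborel. norm (g x - f x)) < e"
  shows "L1_translation_continuous f"
  unfolding L1_translation_continuous_def
proof (intro allI impI)
  fix e :: real assume "e > 0"
  then obtain g where g: "integrable lborel g" "L1_translation_continuous g"
    and fg: "(LINT x|lborel. norm (g x - f x)) < e / 3"
    using appr[of "e / 3"] by auto
  have "e / 3 > 0" using \<open>e > 0\<close> by simp
  then obtain d where "d > 0"
    and d: "\<And>h. norm h < d \<Longrightarrow> (LINT x|lborel. norm (g (h + x) - g x)) < e / 3"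
    using g(2)[unfolded L1_translation_continuous_def, rule_format, OF \<open>e / 3 > 0\<close>] by blast
  have "(LINT x|lborel. norm (f (h + x) - f x)) < e" if "norm h < d" for h
  proof -
    note [simp] = f g(1) integrable_lborel_translate[OF f] integrable_lborel_translate[OF g(1)]
    note [measurable] = borel_measurable_integrable[OF f] borel_measurable_integrable[OF g(1)]
    have "(LINT x|lborel. norm (f (h + x) - f x)) \<le>
        (LINT x|lborel. norm (g (h + x) - f (h + x)) + norm (g (h + x) - g x) + norm (g x - f x))"
    proof (rule integral_mono)
      show "norm (f (h + x) - f x) \<le>
        norm (g (h + x) - f (h + x)) + norm (g (h + x) - g x) + norm (g x - f x)" for x
        by norm
    qed auto
    also have "\<dots> = (LINT x|lborel. norm (g (h + x) - f (h + x)))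
        + (LINT x|lborel. norm (g (h + x) - g x)) + (LINT x|lborel. norm (g x - f x))"
      by simp
    also have "(LINT x|lborel. norm (g (h + x) - f (h + x))) = (LINT x|lborel. norm (g x - f x))"
      by (intro integral_lborel_translate[where f = "\<lambda>x. norm (g x - f x)"]) measurable
    finally show ?thesis using fg d[OF that] by linarith
  qed
  with \<open>d > 0\<close> show "\<exists>d>0. \<forall>h. norm h < d \<longrightarrow> (LINT x|lborel. norm (f (h + x) - f x)) < e"
    by blast
qed

text \<open>
  Regularity of Lebesgue measure. Boundedness makes the closed inner set compact, hence at positive
  distance from the complement of the outer one; that distance is what the next lemma needs.
\<close>

lemma compact_open_sandwich:
  fixes A :: "'a::euclidean_space set"
  assumes "A \<in> sets borel" "bounded A" "0 < e"
  obtains K U where "compact K" "open U" "K \<subseteq> A" "A \<subseteq> U" "emeasure lborel (U - K) < ennreal e"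
proof -
  have A: "A \<in> sets lebesgue" using assms(1) by (intro sets_completionI_sets) simp
  have e2: "0 < e / 2" using assms(3) by simp
  obtain U where U: "open U" "A \<subseteq> U" "emeasure lebesgue (U - A) < ennreal (e / 2)"
    by (rule sets_lebesgue_outer_open[OF A e2])
  obtain K where K: "closed K" "K \<subseteq> A" "emeasure lebesgue (A - K) < ennreal (e / 2)"
    by (rule sets_lebesgue_inner_closed[OF A e2])
  have [measurable]: "U \<in> sets borel" "K \<in> sets borel" "A \<in> sets borel"
    using U(1) K(1) assms(1) by (auto intro: borel_open borel_closed)
  have "U - K = (U - A) \<union> (A - K)" using U(2) K(2) by blast
  then have "emeasure lborel (U - K) = emeasure lborel ((U - A) \<union> (A - K))" by simp
  also have "\<dots> \<le> emeasure lborel (U - A) + emeasure lborel (A - K)"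
    by (intro emeasure_subadditive) simp_all
  also have "\<dots> < ennreal (e / 2) + ennreal (e / 2)"
    using U(3) K(3) by (intro add_strict_mono) simp_all
  also have "\<dots> = ennreal e" using e2 by (simp flip: ennreal_plus)
  finally have less: "emeasure lborel (U - K) < ennreal e" .
  have "compact K"
    using K(1,2) assms(2) bounded_subset compact_eq_bounded_closed by metis
  then show ?thesis using U(1,2) K(2) less by (intro that)
qed

text \<open>
  If \<open>K \<subseteq> A \<subseteq> U\<close> and the shift \<^term>\<open>h\<close> is shorter than the distance from \<^term>\<open>K\<close> to the complement of
  \<^term>\<open>U\<close>, then \<^term>\<open>x\<close> and \<open>h + x\<close> can be separated by \<^term>\<open>A\<close> only if one of them lies in \<open>U - K\<close>,
  a set of small measure.
\<close>

lemma L1_translation_continuous_indicator_bounded: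
  fixes A :: "'a::euclidean_space set" and c :: "'b::{banach, second_countable_topology}"
  assumes A: "A \<in> sets borel" "bounded A"
  shows "L1_translation_continuous (\<lambda>x. indicator A x *\<^sub>R c)"
  unfolding L1_translation_continuous_def
proof (intro allI impI)
  fix e :: real assume "e > 0"
  define e' where "e' = e / (2 * (norm c + 1))"
  have "e' > 0" using \<open>e > 0\<close> by (simp add: e'_def add_nonneg_pos)
  then obtain K U where KU: "compact K" "open U" "K \<subseteq> A" "A \<subseteq> U"
    and m: "emeasure lborel (U - K) < ennreal e'"
    using compact_open_sandwich[OF A] by metis
  have [measurable]: "K \<in> sets borel" "U \<in> sets borel"
    using KU by (auto intro: borel_closed compact_imp_closed)
  have "\<exists>d>0. \<forall>x\<in>K. \<forall>y\<in>-U. d \<le> dist x y"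
    using KU by (intro separate_compact_closed) auto
  then obtain d where "d > 0" and d: "\<And>x y. x \<in> K \<Longrightarrow> y \<notin> U \<Longrightarrow> d \<le> dist x y"
    by auto
  have int: "integrable lborel (indicat_real (U - K))"
    using KU m by (intro integrable_real_indicator) (auto intro: less_trans[OF m])
  have intA: "integrable lborel (indicat_real A)"
    using A emeasure_bounded_finite[OF A(2)] by (intro integrable_real_indicator) auto
  have mm: "measure lborel (U - K) < e'"
  proof -
    have "emeasure lborel (U - K) \<noteq> top" using m by auto
    then show ?thesis using m by (simp add: emeasure_eq_ennreal_measure ennreal_less_iff)
  qed
  have "(LINT x|lborel. norm (indicator A (h + x) *\<^sub>R c - indicator A x *\<^sub>R c)) < e"
    if "norm h < d" for h
  proof -
    note [simp] = int intA integrable_lborel_translate[OF int] integrable_lborel_translate[OF intA]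
    have pw: "\<bar>indicat_real A (h + x) - indicat_real A x\<bar>
        \<le> indicat_real (U - K) (h + x) + indicat_real (U - K) x" for x
    proof -
      have "h + x \<in> U" if "x \<in> K" using d[OF that, of "h + x"] \<open>norm h < d\<close> by (auto simp: dist_norm)
      moreover have "x \<in> U" if "h + x \<in> K" using d[OF that, of x] \<open>norm h < d\<close> by (auto simp: dist_norm)
      ultimately show ?thesis using KU by (auto simp: indicator_def)
    qed
    have "(LINT x|lborel. norm (indicator A (h + x) *\<^sub>R c - indicator A x *\<^sub>R c))
        = (LINT x|lborel. \<bar>indicat_real A (h + x) - indicat_real A x\<bar> * norm c)"
      by (simp add: scaleR_diff_left[symmetric])
    also have "\<dots> \<le> (LINT x|lborel. (indicat_real (U - K) (h + x) + indicat_real (U - K) x) * norm c)"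
      by (intro integral_mono mult_right_mono pw) auto
    also have "\<dots> = (measure lborel (U - K) + measure lborel (U - K)) * norm c"
      using KU by (simp add: integral_lborel_translate[of "indicat_real (U - K)"])
    also have "\<dots> \<le> (2 * e') * norm c"
      using mm by (intro mult_right_mono) auto
    also have "\<dots> < (2 * e') * (norm c + 1)" using \<open>e' > 0\<close> by simp
    also have "\<dots> = e" using norm_ge_zero[of c] by (simp add: e'_def field_simps del: norm_ge_zero)
    finally show ?thesis .
  qed
  with \<open>d > 0\<close> show "\<exists>d>0. \<forall>h. norm h < d \<longrightarrow>
      (LINT x|lborel. norm (indicator A (h + x) *\<^sub>R c - indicator A x *\<^sub>R c)) < e"
    by blast
qed

text \<open>
  Dominated convergence turns the pointwise limit into an \<open>L\<^sup>1\<close>-limit.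
\<close>

lemma L1_translation_continuous_limit:
  fixes f :: "'a::euclidean_space \<Rightarrow> 'b::{banach, second_countable_topology}"
  assumes f: "integrable lborel f"
    and s: "\<And>i::nat. integrable lborel (s i)" "\<And>i. L1_translation_continuous (s i)"
      "\<And>x. (\<lambda>i. s i x) \<longlonglongrightarrow> f x" "\<And>i x. norm (s i x) \<le> 2 * norm (f x)"
  shows "L1_translation_continuous f"
proof (rule L1_translation_continuous_approx[OF f])
  fix e :: real assume "e > 0"
  note [measurable] = borel_measurable_integrable[OF f] borel_measurable_integrable[OF s(1)]
  have "(\<lambda>i. LINT x|lborel. norm (s i x - f x)) \<longlonglongrightarrow> (LINT x::'a|lborel. (0::real))"
  proof (rule integral_dominated_convergence[where w = "\<lambda>x. 3 * norm (f x)"])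
    show "AE x in lborel. (\<lambda>i. norm (s i x - f x)) \<longlonglongrightarrow> 0"
      by (intro AE_I2 tendsto_norm_zero LIM_zero s(3))
    show "AE x in lborel. norm (norm (s i x - f x)) \<le> 3 * norm (f x)" for i
    proof (rule AE_I2)
      show "norm (norm (s i x - f x)) \<le> 3 * norm (f x)" for x
        using norm_triangle_ineq4[of "s i x" "f x"] s(4)[of i x] by simp
    qed
  qed (use f in auto)
  then have "\<forall>\<^sub>F i in sequentially. (LINT x|lborel. norm (s i x - f x)) < e"
    using \<open>e > 0\<close> by (intro order_tendstoD(2)) auto
  then obtain i where "(LINT x|lborel. norm (s i x - f x)) < e"
    by (auto simp: eventually_sequentially)
  then show "\<exists>g. integrable lborel g \<and> L1_translation_continuous g \<and>
      (LINT x|lborel. norm (g x - f x)) < e"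
    using s by blast
qed

lemma L1_translation_continuous_add:
  fixes f g :: "'a::euclidean_space \<Rightarrow> 'b::{banach, second_countable_topology}"
  assumes int: "integrable lborel f" "integrable lborel g"
    and L1: "L1_translation_continuous f" "L1_translation_continuous g"
  shows "L1_translation_continuous (\<lambda>x. f x + g x)"
  unfolding L1_translation_continuous_def
proof (intro allI impI)
  fix e :: real assume "e > 0"
  then have "e / 2 > 0" by simp
  obtain d1 where "d1 > 0"
    and d1: "\<forall>h. norm h < d1 \<longrightarrow> (LINT x|lborel. norm (f (h + x) - f x)) < e / 2"
    using L1(1)[unfolded L1_translation_continuous_def, rule_format, OF \<open>e / 2 > 0\<close>] by blast
  obtain d2 where "d2 > 0"
    and d2: "\<forall>h. norm h < d2 \<longrightarrow> (LINT x|lborel. norm (g (h + x) - g x)) < e / 2"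
    using L1(2)[unfolded L1_translation_continuous_def, rule_format, OF \<open>e / 2 > 0\<close>] by blast
  have "(LINT x|lborel. norm (f (h + x) + g (h + x) - (f x + g x))) < e"
    if "norm h < min d1 d2" for h
  proof -
    note [simp] = int int[THEN integrable_lborel_translate]
    have "(LINT x|lborel. norm (f (h + x) + g (h + x) - (f x + g x)))
        \<le> (LINT x|lborel. norm (f (h + x) - f x) + norm (g (h + x) - g x))"
      by (rule integral_mono) (auto intro: norm_diff_triangle_ineq)
    also have "\<dots> = (LINT x|lborel. norm (f (h + x) - f x)) + (LINT x|lborel. norm (g (h + x) - g x))"
      by simp
    also have "\<dots> < e" using d1[rule_format, of h] d2[rule_format, of h] that by simp
    finally show ?thesis .
  qed
  then show "\<exists>d>0. \<forall>h. norm h < d \<longrightarrow>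
      (LINT x|lborel. norm (f (h + x) + g (h + x) - (f x + g x))) < e"
    using \<open>d1 > 0\<close> \<open>d2 > 0\<close> by (intro exI[of _ "min d1 d2"]) auto
qed

text \<open>
  Continuity of translations in \<open>L\<^sup>1\<close>, by the standard induction over integrable functions. The
  base case asks for sets of finite measure, which are exhausted by their bounded parts.
\<close>

proposition integrable_L1_translation_continuous:
  fixes f :: "'a::euclidean_space \<Rightarrow> 'b::{banach, second_countable_topology}"
  assumes "integrable lborel f"
  shows "L1_translation_continuous f"
  using assms
proof induction
  case (base A c)
  then have [measurable]: "A \<in> sets borel" by simp
  have int: "integrable lborel (\<lambda>x. indicator S x *\<^sub>R c)" if "S \<in> sets borel" "S \<subseteq> A" for S
  proof -
    have "emeasure lborel S \<le> emeasure lborel A" using that base by (intro emeasure_mono) auto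
    then show ?thesis using that base by (intro integrable_scaleR_left integrable_real_indicator)
        (auto simp: le_less_trans)
  qed
  show ?case
  proof (rule L1_translation_continuous_limit[where s = "\<lambda>i x. indicator (A \<inter> cball 0 (real i)) x *\<^sub>R c"])
    show "L1_translation_continuous (\<lambda>x. indicator (A \<inter> cball 0 (real i)) x *\<^sub>R c)" for i
      by (intro L1_translation_continuous_indicator_bounded) (auto intro: bounded_Int)
    show "(\<lambda>i. indicator (A \<inter> cball 0 (real i)) x *\<^sub>R c) \<longlonglongrightarrow> indicator A x *\<^sub>R c" for x
    proof (rule tendsto_eventually)
      obtain N where "norm x \<le> real N" using real_arch_simple by blast
      then show "\<forall>\<^sub>F i in sequentially. indicator (A \<inter> cball 0 (real i)) x *\<^sub>R c = indicator A x *\<^sub>R c"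
        by (auto simp: eventually_sequentially indicator_def intro!: exI[of _ N])
    qed
    show "norm (indicator (A \<inter> cball 0 (real i)) x *\<^sub>R c)
        \<le> 2 * norm (indicator A x *\<^sub>R c)" for i x
      by (simp add: indicator_def)
    show "integrable lborel (\<lambda>x. indicator A x *\<^sub>R c)" by (rule int) simp_all
    show "integrable lborel (\<lambda>x. indicator (A \<inter> cball 0 (real i)) x *\<^sub>R c)" for i
      by (rule int) simp_all
  qed
next
  case (add f g)
  then show ?case by (intro L1_translation_continuous_add)
next
  case (lim f s)
  show ?case
  proof (rule L1_translation_continuous_limit[OF lim(4) lim(1) lim(5)])
    show "(\<lambda>i. s i x) \<longlonglongrightarrow> f x" for x using lim(2) by simp
    show "norm (s i x) \<le> 2 * norm (f x)" for i x using lim(3) by simp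
  qed
qed

section \<open>Approximation of the identity\<close>

lemma
  fixes f g :: "'a \<Rightarrow> complex"
  assumes f: "integrable M f" and g [measurable]: "g \<in> borel_measurable M"
    and bd: "\<And>x. norm (g x) \<le> C"
  shows integrable_bounded_mult: "integrable M (\<lambda>x. g x * f x)"
    and integral_norm_bounded_mult: "(LINT x|M. norm (g x * f x)) \<le> C * (LINT x|M. norm (f x))"
    and norm_integral_bounded_mult: "norm (LINT x|M. g x * f x) \<le> C * (LINT x|M. norm (f x))"
proof -
  note [measurable] = borel_measurable_integrable[OF f]
  have C: "0 \<le> C" by (rule order_trans[OF norm_ge_zero bd])
  have le: "norm (g x * f x) \<le> C * norm (f x)" for x
    using bd[of x] by (simp add: norm_mult mult_right_mono)
  have Cf: "integrable M (\<lambda>x. C * norm (f x))" using f by simp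
  show int: "integrable M (\<lambda>x. g x * f x)"
  proof (rule Bochner_Integration.integrable_bound[OF Cf])
    show "AE x in M. norm (g x * f x) \<le> norm (C * norm (f x))"
      using le C by (intro AE_I2) (simp add: abs_mult)
  qed measurable
  have "(LINT x|M. norm (g x * f x)) \<le> (LINT x|M. C * norm (f x))"
    by (rule integral_mono[OF integrable_norm[OF int] Cf le])
  then show *: "(LINT x|M. norm (g x * f x)) \<le> C * (LINT x|M. norm (f x))" by simp
  show "norm (LINT x|M. g x * f x) \<le> C * (LINT x|M. norm (f x))"
    by (rule order_trans[OF integral_norm_bound *])
qed

text \<open>
  Integrability on the product space, in the one form in which Fubini's theorem is used below: the
  inner integrals are bounded uniformly in the outer variable.
\<close>

lemma integrable_pair_mult:
  fixes f :: "'a::euclidean_space \<Rightarrow> complex" and g :: "'a \<Rightarrow> 'a \<Rightarrow> complex"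
  assumes f: "integrable lborel f" and g: "\<And>x. integrable lborel (g x)"
    and g_meas [measurable]: "(\<lambda>(x, y). g x y) \<in> borel_measurable (borel \<Otimes>\<^sub>M borel)"
    and bd: "\<And>x. (LINT y|lborel. norm (g x y)) \<le> C"
  shows "integrable (lborel \<Otimes>\<^sub>M lborel) (\<lambda>(x, y). f x * g x y)"
proof (rule lborel_pair.Fubini_integrable)
  note [measurable] = borel_measurable_integrable[OF f]
  show "(\<lambda>(x, y). f x * g x y) \<in> borel_measurable (lborel \<Otimes>\<^sub>M lborel)" by measurable
  have "integrable lborel (\<lambda>x. norm (of_real (LINT y|lborel. norm (g x y)) * f x))"
    by (intro integrable_norm integrable_bounded_mult[OF f, where C = C]) (use bd in auto)
  then show "integrable lborel (\<lambda>x. LINT y|lborel. norm (case (x, y) of (x, y) \<Rightarrow> f x * g x y))"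
    by (simp add: norm_mult mult.commute)
  show "AE x in lborel. integrable lborel (\<lambda>y. case (x, y) of (x, y) \<Rightarrow> f x * g x y)"
    using g by simp
qed

text \<open>
  The mollifications of \<^term>\<open>f\<close> converge to \<^term>\<open>f\<close> weakly against bounded functions. After a change
  of variables and Fubini, the left-hand integral is the \<open>mollifier\<close>-average over small \<^term>\<open>h\<close> of
  \<open>\<integral> g(x) f(h + x) dx\<close>, which is continuous in \<^term>\<open>h\<close> because translations are continuous in \<open>L\<^sup>1\<close>.
\<close>

proposition mollifier_approximate_identity:
  fixes f g :: "real^'n \<Rightarrow> complex"
  assumes f: "integrable lborel f" and g [measurable]: "g \<in> borel_measurable borel"
    and bd: "\<And>x. norm (g x) \<le> M" and "e > 0"
  shows "\<exists>d>0. \<forall>\<epsilon>. 0 < \<epsilon> \<and> \<epsilon> < d \<longrightarrow>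
    norm ((LINT x|lborel. g x * (LINT y|lborel. of_real (mollifier \<epsilon> (y - x)) * f y))
      - (LINT x|lborel. g x * f x)) \<le> e"
proof -
  have M: "0 \<le> M" by (rule order_trans[OF norm_ge_zero bd])
  note [measurable] = borel_measurable_integrable[OF f]
  \<comment> \<open>Dividing by \<open>M + 1\<close> rather than by \<open>M\<close> keeps the quotient positive when \<open>M = 0\<close>.\<close>
  have "e / (M + 1) > 0" using M \<open>e > 0\<close> by simp
  obtain d where "d > 0"
    and d: "\<And>h. norm h < d \<Longrightarrow> (LINT x|lborel. norm (f (h + x) - f x)) < e / (M + 1)"
    using integrable_L1_translation_continuous[OF f, unfolded L1_translation_continuous_def,
        rule_format, OF \<open>e / (M + 1) > 0\<close>] by blast
  have f_trans: "integrable lborel (\<lambda>x. f (h + x))" for h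
    by (rule integrable_lborel_translate[OF f])
  have gf: "integrable lborel (\<lambda>x. g x * f (h + x))" for h
    by (rule integrable_bounded_mult[OF f_trans _ bd]) measurable
  define H where "H h = (LINT x|lborel. g x * f (h + x))" for h
  define N where "N = (LINT x|lborel. norm (f x))"
  have N: "(LINT x|lborel. norm (f (h + x))) = N" for h
    unfolding N_def by (intro integral_lborel_translate[of "\<lambda>x. norm (f x)"]) measurable
  have H_diff: "norm (H h - H 0) \<le> e" if "norm h < d" for h
  proof -
    have "H h - H 0 = (LINT x|lborel. g x * f (h + x) - g x * f (0 + x))"
      unfolding H_def by (rule Bochner_Integration.integral_diff[OF gf gf, symmetric])
    also have "\<dots> = (LINT x|lborel. g x * (f (h + x) - f x))"
      by (simp add: right_diff_distrib)
    also have "norm \<dots> \<le> M * (LINT x|lborel. norm (f (h + x) - f x))"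
      by (rule norm_integral_bounded_mult[OF Bochner_Integration.integrable_diff[OF f_trans f] _ bd])
        measurable
    also have "\<dots> \<le> M * (e / (M + 1))"
      using d[OF that] M by (intro mult_left_mono) auto
    also have "\<dots> \<le> e" using M \<open>e > 0\<close> by (simp add: field_simps)
    finally show ?thesis .
  qed
  have "norm ((LINT x|lborel. g x * (LINT y|lborel. of_real (mollifier \<epsilon> (y - x)) * f y))
      - (LINT x|lborel. g x * f x)) \<le> e" if \<epsilon>: "0 < \<epsilon>" "\<epsilon> < d" for \<epsilon>
  proof -
    let ?\<rho> = "\<lambda>h. complex_of_real (mollifier \<epsilon> (h :: real^'n))"
    have \<rho>_int: "integrable lborel ?\<rho>"
      using mollifier_integrable[OF \<epsilon>(1), where 'a = 'n] by (rule integrable_of_real)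
    have \<rho>_int_eq: "(LINT h|lborel. ?\<rho> h) = 1"
      using mollifier_integral[OF \<epsilon>(1), where 'n = 'n] by simp
    have F_int: "integrable (lborel \<Otimes>\<^sub>M lborel) (\<lambda>(h, x). ?\<rho> h * (g x * f (h + x)))"
    proof (rule integrable_pair_mult[OF \<rho>_int gf])
      show "(LINT x|lborel. norm (g x * f (h + x))) \<le> M * N" for h
        unfolding N[of h, symmetric]
        by (rule integral_norm_bounded_mult[OF f_trans _ bd]) measurable
    qed measurable
    have H_int: "integrable lborel (\<lambda>h. ?\<rho> h * H h)"
      using lborel_pair.integrable_fst[OF F_int] by (simp add: H_def)
    have "(LINT x|lborel. g x * (LINT y|lborel. ?\<rho> (y - x) * f y))
        = (LINT x|lborel. (LINT h|lborel. ?\<rho> h * (g x * f (h + x))))"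
    proof (rule Bochner_Integration.integral_cong[OF refl])
      fix x
      have "(LINT y|lborel. ?\<rho> (y - x) * f y) = (LINT h|lborel. ?\<rho> (x + h - x) * f (x + h))"
        by (rule integral_lborel_translate[symmetric]) measurable
      then have "g x * (LINT y|lborel. ?\<rho> (y - x) * f y) = g x * (LINT h|lborel. ?\<rho> h * f (h + x))"
        by (simp add: add.commute)
      also have "\<dots> = (LINT h|lborel. g x * (?\<rho> h * f (h + x)))"
        by (rule integral_mult_right_zero[symmetric])
      also have "\<dots> = (LINT h|lborel. ?\<rho> h * (g x * f (h + x)))"
        by (simp add: mult.left_commute)
      finally show "g x * (LINT y|lborel. ?\<rho> (y - x) * f y) = (LINT h|lborel. ?\<rho> h * (g x * f (h + x)))" .
    qed
    also have "\<dots> = (LINT h|lborel. ?\<rho> h * H h)"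
      using lborel_pair.Fubini_integral[OF F_int] by (simp add: H_def)
    finally have 1: "(LINT x|lborel. g x * (LINT y|lborel. ?\<rho> (y - x) * f y)) = (LINT h|lborel. ?\<rho> h * H h)" .
    have "(LINT h|lborel. ?\<rho> h * H 0) = H 0"
      unfolding integral_mult_left_zero \<rho>_int_eq by simp
    then have 2: "(LINT x|lborel. g x * f x) = (LINT h|lborel. ?\<rho> h * H 0)"
      by (simp add: H_def)
    have H0_int: "integrable lborel (\<lambda>h. ?\<rho> h * H 0)"
      using \<rho>_int by simp
    have "(LINT h|lborel. ?\<rho> h * H h) - (LINT h|lborel. ?\<rho> h * H 0)
        = (LINT h|lborel. ?\<rho> h * H h - ?\<rho> h * H 0)"
      by (rule Bochner_Integration.integral_diff[OF H_int H0_int, symmetric])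
    also have "norm \<dots> \<le> (LINT h|lborel. mollifier \<epsilon> (h :: real^'n) * e)"
    proof (rule Bochner_Integration.integral_norm_bound_integral)
      show "integrable lborel (\<lambda>h. ?\<rho> h * H h - ?\<rho> h * H 0)"
        by (rule Bochner_Integration.integrable_diff[OF H_int H0_int])
      show "integrable lborel (\<lambda>h :: real^'n. mollifier \<epsilon> h * e)"
        by (intro integrable_mult_left mollifier_integrable \<epsilon>(1))
      fix h :: "real^'n"
      show "norm (?\<rho> h * H h - ?\<rho> h * H 0) \<le> mollifier \<epsilon> h * e"
      proof (cases "norm h < \<epsilon>")
        case True
        then have "norm (H h - H 0) \<le> e" using H_diff \<epsilon> by simp
        then show ?thesis using mollifier_nonneg[OF \<epsilon>(1), of h]
          by (simp add: norm_mult mult_left_mono flip: right_diff_distrib)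
      next
        case False
        then show ?thesis using mollifier_eq_0[of \<epsilon> h] \<epsilon> by simp
      qed
    qed
    also have "\<dots> = e" using mollifier_integral[OF \<epsilon>(1), where 'n = 'n] by simp
    finally show ?thesis unfolding 1 2 .
  qed
  with \<open>d > 0\<close> show ?thesis by blast
qed

section \<open>Complex directional derivatives and squares\<close>

text \<open>
  The derivative in a direction with complex coordinates, that is, \<open>\<partial>\<^sub>a \<phi> + i \<partial>\<^sub>b \<phi>\<close> for \<open>z = a + i b\<close>.
  For suitable \<^term>\<open>z\<close> it is a Cauchy--Riemann operator in a two-dimensional plane, so that complex
  eigenvectors can be treated on the same footing as real ones.
\<close>

definition cderiv :: "complex^'n \<Rightarrow> (real^'n \<Rightarrow> real) \<Rightarrow> real^'n \<Rightarrow> complex" where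
  "cderiv z \<phi> x = (\<Sum>j\<in>UNIV. z $ j * of_real (gradient \<phi> x $ j))"

text \<open>
  The equation \<open>\<partial>\<^sub>z f = 0\<close> in the sense of distributions on \<^term>\<open>\<Omega>\<close>. The integral extends over the
  whole space, as the derivative of a test function vanishes off \<^term>\<open>\<Omega>\<close>.
\<close>

definition weak_cderiv_zero :: "(real^'n) set \<Rightarrow> complex^'n \<Rightarrow> (real^'n \<Rightarrow> complex) \<Rightarrow> bool" where
  "weak_cderiv_zero \<Omega> z f \<longleftrightarrow> (\<forall>\<phi> \<in> test_functions \<Omega>. (LINT x|lborel. cderiv z \<phi> x * f x) = 0)"

lemma cderiv_add: "cderiv (z + w) \<phi> x = cderiv z \<phi> x + cderiv w \<phi> x"
  by (simp add: cderiv_def algebra_simps sum.distrib)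

lemma cderiv_scale: "cderiv (c *s z) \<phi> x = c * cderiv z \<phi> x"
  by (simp add: cderiv_def sum_distrib_left mult.assoc)

lemma cderiv_mult:
  assumes "f differentiable (at x)" "g differentiable (at x)"
  shows "cderiv z (\<lambda>x. f x * g x) x = of_real (f x) * cderiv z g x + of_real (g x) * cderiv z f x"
  by (simp add: cderiv_def gradient_mult[OF assms] sum_distrib_left sum.distrib[symmetric] algebra_simps)

lemma cderiv_translate:
  "f differentiable (at (x - c)) \<Longrightarrow> cderiv z (\<lambda>x. f (x - c)) x = cderiv z f (x - c)"
  by (simp add: cderiv_def gradient_translate)

lemma cderiv_reflect:
  "f differentiable (at (y - x)) \<Longrightarrow> cderiv z (\<lambda>x. f (y - x)) x = - cderiv z f (y - x)"
  by (simp add: cderiv_def gradient_reflect sum_negf)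

lemma cderiv_measurable:
  assumes "\<phi> \<in> test_functions \<Omega>"
  shows "cderiv z \<phi> \<in> borel_measurable borel"
proof -
  have "continuous_on UNIV (cderiv z \<phi>)"
    unfolding cderiv_def[abs_def] by (intro continuous_intros continuous_on_gradient[OF assms])
  then show ?thesis by (rule borel_measurable_continuous_onI)
qed

lemma cderiv_bounded:
  assumes "\<phi> \<in> test_functions \<Omega>"
  obtains C where "0 \<le> C" "\<And>x. norm (cderiv z \<phi> x) \<le> C"
proof -
  obtain M where M: "0 \<le> M" "\<And>x. norm (gradient \<phi> x) \<le> M"
    using gradient_bounded[OF assms] by blast
  have "norm (cderiv z \<phi> x) \<le> (\<Sum>j\<in>UNIV. norm (z $ j) * M)" for x
    unfolding cderiv_def
  proof (rule sum_norm_le)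
    fix j
    have "\<bar>gradient \<phi> x $ j\<bar> \<le> M"
      using component_le_norm_cart[of "gradient \<phi> x" j] M(2)[of x] by linarith
    then show "norm (z $ j * of_real (gradient \<phi> x $ j)) \<le> norm (z $ j) * M"
      by (simp add: norm_mult mult_left_mono)
  qed
  then show thesis using that[of "\<Sum>j\<in>UNIV. norm (z $ j) * M"] M(1)
    by (simp add: sum_nonneg)
qed

lemma cderiv_integrable:
  assumes "\<phi> \<in> test_functions \<Omega>" "integrable lborel f"
  shows "integrable lborel (\<lambda>x. cderiv z \<phi> x * f x)"
proof -
  obtain C where "\<And>x. norm (cderiv z \<phi> x) \<le> C" using cderiv_bounded[OF assms(1)] by blast
  then show ?thesis
    by (rule integrable_bounded_mult[OF assms(2), rotated]) (simp add: cderiv_measurable[OF assms(1)])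
qed

text \<open>
  A compact subset of an open set has positive distance from the complement.
\<close>

lemma compact_support_room:
  assumes "open \<Omega>" "\<phi> \<in> test_functions \<Omega>"
  obtains d where "d > 0" "\<And>x \<epsilon>. \<phi> x \<noteq> 0 \<Longrightarrow> \<epsilon> < d \<Longrightarrow> cball x \<epsilon> \<subseteq> \<Omega>"
proof -
  have "\<exists>d>0. \<forall>x \<in> closure {x. \<phi> x \<noteq> 0}. \<forall>y \<in> - \<Omega>. d \<le> dist x y"
    by (rule separate_compact_closed) (use assms test_functionD[OF assms(2)] in auto)
  then obtain d where "d > 0" and d: "\<And>x y. x \<in> closure {x. \<phi> x \<noteq> 0} \<Longrightarrow> y \<notin> \<Omega> \<Longrightarrow> d \<le> dist x y"
    by auto
  have "cball x \<epsilon> \<subseteq> \<Omega>" if "\<phi> x \<noteq> 0" "\<epsilon> < d" for x \<epsilon>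
  proof
    fix y assume "y \<in> cball x \<epsilon>"
    have "x \<in> closure {x. \<phi> x \<noteq> 0}" using that(1) closure_subset[of "{x. \<phi> x \<noteq> 0}"] by auto
    then show "y \<in> \<Omega>" using d[of x y] \<open>y \<in> cball x \<epsilon>\<close> that(2) by force
  qed
  with \<open>d > 0\<close> show thesis by (rule that)
qed

text \<open>
  For smooth \<^term>\<open>f\<close> this is the chain rule, and for complex \<^term>\<open>z\<close> it says that the square of a
  holomorphic function is holomorphic. For merely bounded \<^term>\<open>f\<close> the product has to be regularised,
  and the proof does so on the level of a double integral: with a mollifier \<open>\<rho>\<close> consider
  \<open>I = \<integral>\<integral> \<partial>\<^sub>z\<phi>(x) f(x) \<rho>(y - x) f(y) dy dx\<close>, which tends to \<open>\<integral> \<partial>\<^sub>z\<phi> f\<^sup>2\<close> as \<open>\<rho>\<close> concentrates at \<open>0\<close>.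
  It actually vanishes. For fixed \<^term>\<open>y\<close> the function \<open>x \<mapsto> \<rho>(y - x) \<phi>(x)\<close> is a test function, and
  testing \<^term>\<open>f\<close> with it moves the derivative from \<open>\<phi>\<close> to \<open>\<rho>\<close>. For fixed \<^term>\<open>x\<close> in the support of
  \<open>\<phi>\<close> the function \<open>y \<mapsto> \<rho>(y - x)\<close> is a test function as well, and testing \<^term>\<open>f\<close> with it shows
  that the term with the derivative of \<open>\<rho>\<close> contributes nothing.
\<close>

proposition weak_cderiv_zero_square:
  fixes \<Omega> :: "(real^'n) set"
  assumes "open \<Omega>" and f: "integrable lborel f" and bd: "\<And>x. norm (f x) \<le> M"
    and weak: "weak_cderiv_zero \<Omega> z f"
  shows "weak_cderiv_zero \<Omega> z (\<lambda>x. (f x)\<^sup>2)"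
  unfolding weak_cderiv_zero_def
proof
  fix \<phi> assume \<phi>: "\<phi> \<in> test_functions \<Omega>"
  note [measurable] = borel_measurable_integrable[OF f] cderiv_measurable[OF \<phi>]
  obtain d0 where "d0 > 0" and room: "\<And>x \<epsilon>. \<phi> x \<noteq> 0 \<Longrightarrow> \<epsilon> < d0 \<Longrightarrow> cball x \<epsilon> \<subseteq> \<Omega>"
    using compact_support_room[OF assms(1) \<phi>] by blast
  obtain C1 where C1: "0 \<le> C1" "\<And>x. norm (cderiv z \<phi> x) \<le> C1"
    using cderiv_bounded[OF \<phi>] by blast
  obtain C2 where C2: "0 \<le> C2" "\<And>x. \<bar>\<phi> x\<bar> \<le> C2"
    using test_function_bounded[OF \<phi>] by blast
  have \<phi>_meas [measurable]: "\<phi> \<in> borel_measurable borel"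
    by (rule borel_measurable_continuous_onI[OF test_functionD(3)[OF \<phi>]])
  define g where "g x = cderiv z \<phi> x * f x" for x
  have g_bd: "norm (g x) \<le> C1 * M" for x
    unfolding g_def norm_mult by (intro mult_mono C1 bd) auto
  have g_meas [measurable]: "g \<in> borel_measurable borel" unfolding g_def[abs_def] by measurable
  have vanish: "(LINT x|lborel. g x * (LINT y|lborel. of_real (mollifier \<epsilon> (y - x)) * f y)) = 0"
    if \<epsilon>: "0 < \<epsilon>" "\<epsilon> < d0" for \<epsilon>
  proof -
    let ?\<rho> = "mollifier \<epsilon> :: real^'n \<Rightarrow> real"
    note \<rho>_test = mollifier_test_function_UNIV[OF \<epsilon>(1), where 'a = 'n]
    note \<rho>_diff = test_functionD(2)[OF \<rho>_test]
    note [measurable] = cderiv_measurable[OF \<rho>_test]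
    obtain C3 where C3: "0 \<le> C3" "\<And>x. norm (cderiv z ?\<rho> x) \<le> C3"
      using cderiv_bounded[OF \<rho>_test] by blast
    obtain C4 where C4: "0 \<le> C4" "\<And>x. \<bar>?\<rho> x\<bar> \<le> C4"
      using test_function_bounded[OF \<rho>_test] by blast
    \<comment> \<open>For fixed \<open>y\<close> the kernel is the derivative of the test function \<open>x \<mapsto> \<rho>(y - x) \<phi>(x)\<close>.\<close>
    define k where "k x y = of_real (?\<rho> (y - x)) * cderiv z \<phi> x - of_real (\<phi> x) * cderiv z ?\<rho> (y - x)" for x y
    have k_meas [measurable]: "(\<lambda>(x, y). k x y) \<in> borel_measurable (borel \<Otimes>\<^sub>M borel)"
      unfolding k_def[abs_def] by measurable
    have k_bd: "norm (k x y) \<le> C4 * C1 + C2 * C3" for x y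
    proof -
      have "norm (k x y) \<le> norm (of_real (?\<rho> (y - x)) * cderiv z \<phi> x)
          + norm (of_real (\<phi> x) * cderiv z ?\<rho> (y - x))"
        unfolding k_def by (rule norm_triangle_ineq4)
      also have "\<dots> \<le> C4 * C1 + C2 * C3"
        unfolding norm_mult norm_of_real by (intro add_mono mult_mono C1 C2 C3 C4 norm_ge_zero)
      finally show ?thesis .
    qed
    have k_int: "integrable lborel (\<lambda>y. k x y * f y)" for x
      by (rule integrable_bounded_mult[OF f _ k_bd]) measurable
    have F_int: "integrable (lborel \<Otimes>\<^sub>M lborel) (\<lambda>(x, y). f x * (k x y * f y))"
    proof (rule integrable_pair_mult[OF f k_int])
      show "(LINT y|lborel. norm (k x y * f y)) \<le> (C4 * C1 + C2 * C3) * (LINT y|lborel. norm (f y))" for x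
        by (rule integral_norm_bounded_mult[OF f _ k_bd]) measurable
    qed measurable
    have inner_x: "(LINT x|lborel. f x * (k x y * f y)) = 0" for y
    proof -
      have "(\<lambda>x. ?\<rho> (x - y) * \<phi> x) \<in> test_functions \<Omega>"
        by (rule test_functions_mult[OF \<phi> C_k_mollifier])
      then have test: "(\<lambda>x. ?\<rho> (y - x) * \<phi> x) \<in> test_functions \<Omega>"
        using mollifier_minus[of \<epsilon> "_ - y"] by simp
      have "cderiv z (\<lambda>x. ?\<rho> (y - x) * \<phi> x) x = k x y" for x
      proof -
        have "(\<lambda>x. ?\<rho> (y - x)) differentiable (at x)"
          using C_k_differentiable[OF C_k_mollifier[of "Suc 0" \<epsilon> y]]
            mollifier_minus[of \<epsilon> "_ - y"] by simp
        then show ?thesis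
          by (simp add: cderiv_mult test_functionD(2)[OF \<phi>] cderiv_reflect \<rho>_diff k_def)
      qed
      then have "(LINT x|lborel. k x y * f x) = 0"
        using weak test unfolding weak_cderiv_zero_def by fastforce
      moreover have "(LINT x|lborel. f x * (k x y * f y)) = (LINT x|lborel. (k x y * f x) * f y)"
        by (simp add: ac_simps)
      ultimately show ?thesis unfolding integral_mult_left_zero by simp
    qed
    have inner_y: "(LINT y|lborel. f x * (k x y * f y))
        = g x * (LINT y|lborel. of_real (?\<rho> (y - x)) * f y)" for x
    proof -
      have 1: "integrable lborel (\<lambda>y. of_real (?\<rho> (y - x)) * f y)"
        by (rule integrable_bounded_mult[OF f, where C = C4]) (use C4 in auto)
      have 2: "integrable lborel (\<lambda>y. cderiv z ?\<rho> (y - x) * f y)"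
        by (rule integrable_bounded_mult[OF f, where C = C3]) (use C3 in auto)
      have 0: "of_real (\<phi> x) * (LINT y|lborel. cderiv z ?\<rho> (y - x) * f y) = 0"
      proof (cases "\<phi> x = 0")
        case False
        have "(\<lambda>y. ?\<rho> (y - x)) \<in> test_functions \<Omega>"
          by (rule mollifier_test_function[OF \<epsilon>(1) room[OF False \<epsilon>(2)]])
        then have "(LINT y|lborel. cderiv z (\<lambda>y. ?\<rho> (y - x)) y * f y) = 0"
          using weak unfolding weak_cderiv_zero_def by blast
        then show ?thesis by (simp add: cderiv_translate \<rho>_diff)
      qed simp
      have "(LINT y|lborel. k x y * f y)
          = (LINT y|lborel. cderiv z \<phi> x * (of_real (?\<rho> (y - x)) * f y)
              - of_real (\<phi> x) * (cderiv z ?\<rho> (y - x) * f y))"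
        by (simp add: k_def algebra_simps)
      also have "\<dots> = (LINT y|lborel. cderiv z \<phi> x * (of_real (?\<rho> (y - x)) * f y))
          - (LINT y|lborel. of_real (\<phi> x) * (cderiv z ?\<rho> (y - x) * f y))"
        by (intro Bochner_Integration.integral_diff integrable_mult_right 1 2)
      also have "\<dots> = cderiv z \<phi> x * (LINT y|lborel. of_real (?\<rho> (y - x)) * f y)"
        unfolding integral_mult_right_zero 0 by simp
      finally show ?thesis unfolding integral_mult_right_zero g_def by simp
    qed
    have "(LINT x|lborel. g x * (LINT y|lborel. of_real (?\<rho> (y - x)) * f y))
        = (LINT x|lborel. LINT y|lborel. f x * (k x y * f y))"
      unfolding inner_y ..
    also have "\<dots> = (LINT y|lborel. LINT x|lborel. f x * (k x y * f y))"
      by (rule lborel_pair.Fubini_integral[OF F_int, symmetric])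
    also have "\<dots> = 0" unfolding inner_x by simp
    finally show ?thesis .
  qed
  have "norm (LINT x|lborel. g x * f x) \<le> e" if "e > 0" for e
  proof -
    obtain d where "d > 0" and d: "\<And>\<epsilon>. 0 < \<epsilon> \<Longrightarrow> \<epsilon> < d \<Longrightarrow>
        norm ((LINT x|lborel. g x * (LINT y|lborel. of_real (mollifier \<epsilon> (y - x)) * f y))
          - (LINT x|lborel. g x * f x)) \<le> e"
      using mollifier_approximate_identity[OF f g_meas g_bd \<open>e > 0\<close>] by blast
    define \<epsilon> where "\<epsilon> = min d d0 / 2"
    have "0 < \<epsilon>" "\<epsilon> < d" "\<epsilon> < d0" using \<open>d > 0\<close> \<open>d0 > 0\<close> by (auto simp: \<epsilon>_def)
    then show ?thesis using d[of \<epsilon>] vanish[of \<epsilon>] by simp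
  qed
  then have "norm (LINT x|lborel. g x * f x) \<le> 0"
    by (rule field_le_epsilon[where y = 0, simplified])
  then show "(LINT x|lborel. cderiv z \<phi> x * (f x)\<^sup>2) = 0"
    by (simp add: g_def power2_eq_square mult.assoc)
qed

section \<open>Induction over generalised eigenvectors\<close>

text \<open>
  The vector \<open>p(T) z\<close>, by Horner's scheme in the vector rather than through powers of the matrix.
\<close>

definition poly_apply :: "complex poly \<Rightarrow> complex^'n^'n \<Rightarrow> complex^'n \<Rightarrow> complex^'n" where
  "poly_apply p T = fold_coeffs (\<lambda>a f z. a *s z + f (T *v z)) p (\<lambda>z. 0)"

lemma poly_apply_0 [simp]: "poly_apply 0 T z = 0"
  by (simp add: poly_apply_def)

lemma poly_apply_pCons [simp]: "poly_apply (pCons a p) T z = a *s z + poly_apply p T (T *v z)"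
  by (cases "a = 0"; cases "p = 0")
    (simp_all add: poly_apply_def fold_coeffs_pCons_coeff_not_0_eq fold_coeffs_pCons_not_0_0_eq)

lemma poly_apply_vec_0 [simp]: "poly_apply p T 0 = 0"
  by (induction p) auto

lemma poly_apply_add: "poly_apply (p + q) T z = poly_apply p T z + poly_apply q T z"
  by (induction p q arbitrary: z rule: poly_induct2) (auto simp: vec.scale_left_distrib)

lemma poly_apply_smult: "poly_apply (smult c p) T z = c *s poly_apply p T z"
  by (induction p arbitrary: z) (auto simp: vec.scale_right_distrib)

lemma poly_apply_vec_add: "poly_apply p T (z + w) = poly_apply p T z + poly_apply p T w"
  by (induction p arbitrary: z w) (auto simp: vec.scale_right_distrib matrix_vector_right_distrib)

lemma poly_apply_vec_scale: "poly_apply p T (c *s z) = c *s poly_apply p T z"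
  by (induction p arbitrary: z) (auto simp: vec.scale_right_distrib matrix_vector_mult_scaleR vec.scale mult.commute
      vector_scalar_commute)

lemma poly_apply_commute: "poly_apply p T (T *v z) = T *v poly_apply p T z"
  by (induction p arbitrary: z) (auto simp: matrix_vector_right_distrib vector_scalar_commute)

lemma poly_apply_linear_factor:
  shows "poly_apply ([:- l, 1:] * q) T z = poly_apply q T (T *v z - l *s z)"
    and "poly_apply ([:- l, 1:] * q) T z = T *v poly_apply q T z - l *s poly_apply q T z"
proof -
  have factor: "[:- l, 1:] * q = smult (- l) q + pCons 0 q" by simp
  have "poly_apply ([:- l, 1:] * q) T z = poly_apply q T (T *v z) - l *s poly_apply q T z"
    unfolding factor poly_apply_add poly_apply_smult by simp
  moreover have "poly_apply q T (T *v z - l *s z) = poly_apply q T (T *v z + (- l) *s z)"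
    by simp
  ultimately show "poly_apply ([:- l, 1:] * q) T z = poly_apply q T (T *v z - l *s z)"
    and "poly_apply ([:- l, 1:] * q) T z = T *v poly_apply q T z - l *s poly_apply q T z"
    unfolding poly_apply_vec_add poly_apply_vec_scale by (simp_all add: poly_apply_commute)
qed

lemma poly_apply_monom: "poly_apply (monom c k) T z = c *s (((*v) T ^^ k) z)"
  by (induction k arbitrary: z) (simp_all add: monom_Suc monom_0 funpow_swap1)

lemma poly_apply_sum: "poly_apply (\<Sum>i\<in>I. p i) T z = (\<Sum>i\<in>I. poly_apply (p i) T z)"
  by (induction I rule: infinite_finite_induct) (auto simp: poly_apply_add)

text \<open>
  The \<open>n + 1\<close> vectors \<open>z, T z, \<dots>, T\<^sup>n z\<close> in an \<open>n\<close>-dimensional space are linearly dependent, or two of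
  them coincide; either way a nontrivial polynomial in \<^term>\<open>T\<close> kills \<^term>\<open>z\<close>.
\<close>

lemma annihilating_polynomial:
  fixes T :: "complex^'n^'n" and z :: "complex^'n"
  shows "\<exists>p. p \<noteq> 0 \<and> poly_apply p T z = 0"
proof (cases "inj_on (\<lambda>k. ((*v) T ^^ k) z) {..CARD('n)}")
  case False
  then obtain i j where "i \<noteq> j" and eq: "((*v) T ^^ i) z = ((*v) T ^^ j) z"
    by (auto simp: inj_on_def)
  then have "monom 1 i + monom (- 1) j \<noteq> (0 :: complex poly)"
    by (auto simp: poly_eq_iff intro!: exI[of _ i])
  moreover have "poly_apply (monom 1 i + monom (- 1) j) T z = 0"
    by (simp add: poly_apply_add poly_apply_monom eq)
  ultimately show ?thesis by blast
next
  case True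
  let ?v = "\<lambda>k. ((*v) T ^^ k) z" and ?I = "{..CARD('n)}"
  have "vec.dependent (?v ` ?I)"
  proof (rule ccontr)
    assume "\<not> ?thesis"
    then have "card (?v ` ?I) \<le> vec.dim (UNIV :: (complex^'n) set)"
      by (rule vec.independent_card_le_dim[rotated]) simp
    then show False using True by (simp add: card_image vec.dim_UNIV card_cart_basis)
  qed
  then obtain u w where w: "w \<in> ?v ` ?I" "u w \<noteq> 0" and sum: "(\<Sum>v\<in>?v ` ?I. u v *s v) = 0"
    by (auto simp: vec.dependent_finite)
  then obtain k where k: "k \<le> CARD('n)" "w = ?v k" by auto
  let ?p = "\<Sum>i\<in>?I. monom (u (?v i)) i"
  have "coeff ?p k = u w"
    using k by (simp add: coeff_sum sum.delta)
  then have "?p \<noteq> 0" using w by auto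
  moreover have "poly_apply ?p T z = 0"
    using sum by (simp add: poly_apply_sum poly_apply_monom sum.reindex[OF True])
  ultimately show ?thesis by blast
qed

text \<open>
  An induction principle that replaces the Jordan normal form. Every vector is killed by some
  polynomial in \<^term>\<open>T\<close>; one linear factor \<open>T - l\<close> is split off at a time. If \<^term>\<open>l\<close> is excluded from the
  spectrum, the factor is injective and may be cancelled. Otherwise the shorter product kills
  \<open>T z - l z\<close>, and the step rule passes from this vector to \<^term>\<open>z\<close>.
\<close>

proposition eigenvalue_induction:
  fixes T :: "complex^'n^'n"
  assumes zero: "P 0"
    and step: "\<And>l z. l \<notin> L \<Longrightarrow> P (T *v z - l *s z) \<Longrightarrow> P z"
    and not_eigenvalue: "\<And>l z. l \<in> L \<Longrightarrow> T *v z = l *s z \<Longrightarrow> z = 0"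
  shows "P z"
proof -
  have "P z" if "p \<noteq> 0" "poly_apply p T z = 0" for p z
    using that
  proof (induction "degree p" arbitrary: p z)
    case 0
    then obtain c where "p = [:c:]" by (metis degree_eq_zeroE)
    with 0 zero show ?case by simp
  next
    case (Suc d)
    then have "\<not> constant (poly p)" by (simp add: constant_degree)
    then obtain l where "poly p l = 0" using fundamental_theorem_of_algebra by blast
    then obtain q where p: "p = [:- l, 1:] * q" by (auto simp: poly_eq_0_iff_dvd dvd_def)
    have "q \<noteq> 0" using Suc.prems p by auto
    then have d: "d = degree q"
      using Suc.hyps(2) degree_mult_eq[of "[:- l, 1:]" q] by (simp add: p del: mult_pCons_left)
    show ?case
    proof (cases "l \<in> L")
      case True
      have "poly_apply q T z = 0"
        using not_eigenvalue[OF True] Suc.prems(2) unfolding p poly_apply_linear_factor(2) by simp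
      then show ?thesis by (rule Suc.hyps(1)[OF d \<open>q \<noteq> 0\<close>])
    next
      case False
      have "poly_apply q T (T *v z - l *s z) = 0"
        using Suc.prems(2) unfolding p poly_apply_linear_factor(1) .
      then have "P (T *v z - l *s z)" by (rule Suc.hyps(1)[OF d \<open>q \<noteq> 0\<close>])
      then show ?thesis by (rule step[OF False])
    qed
  qed
  then show ?thesis using annihilating_polynomial by blast
qed

section \<open>Two phases\<close>

text \<open>
  The heart of the matter. Let \<^term>\<open>u\<close> and \<^term>\<open>v\<close> be the indicators of two disjoint sets, related by
  \<open>\<partial>\<^sub>z u + \<partial>\<^bsub>Tz\<^esub> v = 0\<close> for all \<^term>\<open>z\<close>. If both derivatives vanish in the direction \<open>T z - l z\<close>, the
  relation says \<open>\<partial>\<^sub>z (u + l v) = 0\<close>. Squaring is allowed, and \<open>(u + l v)\<^sup>2 = u + l\<^sup>2 v\<close> because the sets are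
  disjoint. Hence \<open>(l\<^sup>2 - l) \<partial>\<^sub>z v = 0\<close>, and for \<open>l \<noteq> 0, 1\<close> both \<open>\<partial>\<^sub>z v\<close> and \<open>\<partial>\<^sub>z u\<close> vanish. The condition
  on \<^term>\<open>l\<close> says that the values \<open>0\<close>, \<open>1\<close>, \<open>l\<close> of \<open>u + l v\<close> are distinct, so that \<open>u + l v\<close> still sees all
  three phases. Induction over the generalised eigenvectors of \<^term>\<open>T\<close> covers all directions.
\<close>

proposition weak_cderiv_zero_two_phases:
  fixes T :: "complex^'n^'n" and u v :: "real^'n \<Rightarrow> complex"
  assumes "open \<Omega>"
    and int: "integrable lborel u" "integrable lborel v"
    and idem: "\<And>x. u x * u x = u x" "\<And>x. v x * v x = v x" "\<And>x. u x * v x = 0"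
    and pair: "\<And>z \<phi>. \<phi> \<in> test_functions \<Omega> \<Longrightarrow>
      (LINT x|lborel. cderiv z \<phi> x * u x) + (LINT x|lborel. cderiv (T *v z) \<phi> x * v x) = 0"
    and T: "\<And>z. T *v z = 0 \<Longrightarrow> z = 0" "\<And>z. T *v z = z \<Longrightarrow> z = 0"
  shows "weak_cderiv_zero \<Omega> z u \<and> weak_cderiv_zero \<Omega> z v"
proof (rule eigenvalue_induction[where T = T and L = "{0, 1}"])
  show "weak_cderiv_zero \<Omega> 0 u \<and> weak_cderiv_zero \<Omega> 0 v"
    by (simp add: weak_cderiv_zero_def cderiv_def)
  show "l \<in> {0, 1} \<Longrightarrow> T *v z = l *s z \<Longrightarrow> z = 0" for l z
    using T by auto
  fix l z
  assume l: "l \<notin> {0, 1 :: complex}"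
    and D: "weak_cderiv_zero \<Omega> (T *v z - l *s z) u \<and> weak_cderiv_zero \<Omega> (T *v z - l *s z) v"
  have split: "(LINT x|lborel. cderiv z \<phi> x * (u x + c * v x))
      = (LINT x|lborel. cderiv z \<phi> x * u x) + c * (LINT x|lborel. cderiv z \<phi> x * v x)"
    if "\<phi> \<in> test_functions \<Omega>" for \<phi> c
  proof -
    have "(LINT x|lborel. cderiv z \<phi> x * (u x + c * v x))
        = (LINT x|lborel. cderiv z \<phi> x * u x + c * (cderiv z \<phi> x * v x))"
      by (simp add: algebra_simps)
    also have "\<dots> = (LINT x|lborel. cderiv z \<phi> x * u x) + (LINT x|lborel. c * (cderiv z \<phi> x * v x))"
      by (intro Bochner_Integration.integral_add integrable_mult_right cderiv_integrable[OF that] int)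
    finally show ?thesis by simp
  qed
  have weak: "weak_cderiv_zero \<Omega> z (\<lambda>x. u x + l * v x)"
    unfolding weak_cderiv_zero_def
  proof
    fix \<phi> assume \<phi>: "\<phi> \<in> test_functions \<Omega>"
    have "T *v z = (T *v z - l *s z) + l *s z" by simp
    then have "(LINT x|lborel. cderiv (T *v z) \<phi> x * v x)
        = (LINT x|lborel. cderiv (T *v z - l *s z) \<phi> x * v x + l * (cderiv z \<phi> x * v x))"
      by (metis (no_types, lifting) cderiv_add cderiv_scale distrib_right mult.assoc)
    also have "\<dots> = (LINT x|lborel. cderiv (T *v z - l *s z) \<phi> x * v x)
        + (LINT x|lborel. l * (cderiv z \<phi> x * v x))"
      by (intro Bochner_Integration.integral_add integrable_mult_right cderiv_integrable[OF \<phi>] int)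
    also have "\<dots> = l * (LINT x|lborel. cderiv z \<phi> x * v x)"
      using D \<phi> by (simp add: weak_cderiv_zero_def)
    finally show "(LINT x|lborel. cderiv z \<phi> x * (u x + l * v x)) = 0"
      using pair[OF \<phi>, of z] by (simp add: split[OF \<phi>])
  qed
  have bd: "norm (u x + l * v x) \<le> 1 + norm l" for x
  proof -
    have "norm (u x) \<le> 1" "norm (v x) \<le> 1" using idem[of x] by auto
    then have "norm (u x) + norm (l * v x) \<le> 1 + norm l"
      by (intro add_mono) (auto simp: norm_mult mult_left_le)
    then show ?thesis using norm_triangle_le by blast
  qed
  have "(u x + l * v x)\<^sup>2 = u x + l\<^sup>2 * v x" for x
  proof -
    have "u x = 0 \<or> u x = 1" "v x = 0 \<or> v x = 1" "u x = 0 \<or> v x = 0"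
      using idem[of x] by auto
    then show ?thesis by (auto simp: power2_eq_square)
  qed
  then have weak2: "weak_cderiv_zero \<Omega> z (\<lambda>x. u x + l\<^sup>2 * v x)"
    using weak_cderiv_zero_square[OF assms(1) _ bd weak] int by simp
  show "weak_cderiv_zero \<Omega> z u \<and> weak_cderiv_zero \<Omega> z v"
    unfolding weak_cderiv_zero_def
  proof (intro conjI ballI)
    fix \<phi> assume \<phi>: "\<phi> \<in> test_functions \<Omega>"
    let ?a = "LINT x|lborel. cderiv z \<phi> x * u x" and ?b = "LINT x|lborel. cderiv z \<phi> x * v x"
    have 1: "?a + l * ?b = 0"
      using weak \<phi> split[OF \<phi>, of l] by (simp add: weak_cderiv_zero_def)
    have 2: "?a + l\<^sup>2 * ?b = 0"
      using weak2 \<phi> split[OF \<phi>, of "l\<^sup>2"] by (simp add: weak_cderiv_zero_def)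
    have "l * (l - 1) * ?b = (?a + l\<^sup>2 * ?b) - (?a + l * ?b)"
      by (simp add: algebra_simps power2_eq_square)
    then have "?b = 0" using l 1 2 by simp
    then show "?a = 0" "?b = 0" using 1 by auto
  qed
qed

section \<open>Sets with vanishing distributional gradient\<close>

lemma test_function_lipschitz:
  fixes \<phi> :: "real^'n \<Rightarrow> real"
  assumes "\<phi> \<in> test_functions \<Omega>"
  obtains L where "0 \<le> L" "\<And>x y. \<bar>\<phi> x - \<phi> y\<bar> \<le> L * norm (x - y)"
proof -
  obtain M where M: "0 \<le> M" "\<And>x. norm (gradient \<phi> x) \<le> M"
    using gradient_bounded[OF assms] by blast
  have "norm (\<phi> x - \<phi> y) \<le> M * norm (x - y)" for x y
  proof (rule differentiable_bound[where S = UNIV])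
    show "(\<phi> has_derivative (\<lambda>h. gradient \<phi> x \<bullet> h)) (at x within UNIV)" for x
      by (rule has_derivative_gradient[OF test_functionD(2)[OF assms]])
    show "onorm (\<lambda>h. gradient \<phi> x \<bullet> h) \<le> M" for x
    proof (rule onorm_le)
      show "norm (gradient \<phi> x \<bullet> h) \<le> M * norm h" for h
        using Cauchy_Schwarz_ineq2[of "gradient \<phi> x" h] M(2)[of x]
        by (simp add: mult_right_mono order_trans)
    qed
  qed auto
  then show thesis using that[OF M(1)] by simp
qed

text \<open>
  Differentiation under the integral sign: test functions are Lipschitz continuous, so a multiple of
  \<open>|f|\<close> dominates all difference quotients.
\<close>

lemma has_derivative_integral_translate:
  fixes \<phi> :: "real^'n \<Rightarrow> real"
  assumes \<phi>: "\<phi> \<in> test_functions \<Omega>" and f: "integrable lborel f"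
  shows "((\<lambda>t. LINT x|lborel. f x * \<phi> (x + t *\<^sub>R a)) has_real_derivative
    (LINT x|lborel. f x * (gradient \<phi> (x + t *\<^sub>R a) \<bullet> a))) (at t)"
  unfolding DERIV_def tendsto_at_iff_sequentially
proof (intro allI impI)
  fix h :: "nat \<Rightarrow> real"
  assume nz: "\<forall>i. h i \<in> UNIV - {0}" and lim: "h \<longlonglongrightarrow> 0"
  obtain L where L: "0 \<le> L" "\<And>x y. \<bar>\<phi> x - \<phi> y\<bar> \<le> L * norm (x - y)"
    using test_function_lipschitz[OF \<phi>] by blast
  obtain M where M: "0 \<le> M" "\<And>x. \<bar>\<phi> x\<bar> \<le> M"
    using test_function_bounded[OF \<phi>] by blast
  have [measurable]: "\<phi> \<in> borel_measurable borel"
    by (rule borel_measurable_continuous_onI[OF test_functionD(3)[OF \<phi>]])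
  have [measurable]: "gradient \<phi> \<in> borel_measurable borel"
    by (rule borel_measurable_continuous_onI[OF continuous_on_gradient[OF \<phi>]])
  note [measurable] = borel_measurable_integrable[OF f]
  have int: "integrable lborel (\<lambda>x. f x * \<phi> (x + s *\<^sub>R a))" for s
  proof (rule Bochner_Integration.integrable_bound)
    show "integrable lborel (\<lambda>x. M * norm (f x))" using f by simp
    show "AE x in lborel. norm (f x * \<phi> (x + s *\<^sub>R a)) \<le> norm (M * norm (f x))"
      using M by (intro AE_I2) (simp add: abs_mult mult.commute[of M] mult_left_mono)
  qed measurable
  let ?q = "\<lambda>i x. f x * ((\<phi> (x + (t + h i) *\<^sub>R a) - \<phi> (x + t *\<^sub>R a)) / h i)"
  have "(\<lambda>i. LINT x|lborel. ?q i x) \<longlonglongrightarrow> (LINT x|lborel. f x * (gradient \<phi> (x + t *\<^sub>R a) \<bullet> a))"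
  proof (rule integral_dominated_convergence)
    show "integrable lborel (\<lambda>x. (L * norm a) * norm (f x))" using f by simp
    show "AE x in lborel. norm (?q i x) \<le> (L * norm a) * norm (f x)" for i
    proof (rule AE_I2)
      fix x
      have "\<bar>\<phi> (x + (t + h i) *\<^sub>R a) - \<phi> (x + t *\<^sub>R a)\<bar> \<le> L * norm (h i *\<^sub>R a)"
        using L(2)[of "x + (t + h i) *\<^sub>R a" "x + t *\<^sub>R a"] by (simp add: algebra_simps)
      then have "\<bar>(\<phi> (x + (t + h i) *\<^sub>R a) - \<phi> (x + t *\<^sub>R a)) / h i\<bar> \<le> L * norm a"
        using nz by (simp add: field_simps)
      then have "\<bar>f x\<bar> * \<bar>(\<phi> (x + (t + h i) *\<^sub>R a) - \<phi> (x + t *\<^sub>R a)) / h i\<bar>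
          \<le> \<bar>f x\<bar> * (L * norm a)"
        by (rule mult_left_mono) simp
      then show "norm (?q i x) \<le> (L * norm a) * norm (f x)"
        unfolding real_norm_def abs_mult by (simp only: mult.commute[of "\<bar>f x\<bar>" "L * norm a"])
    qed
    show "AE x in lborel. (\<lambda>i. ?q i x) \<longlonglongrightarrow> f x * (gradient \<phi> (x + t *\<^sub>R a) \<bullet> a)"
    proof (rule AE_I2)
      fix x
      have "((\<lambda>s. x + s *\<^sub>R a) has_derivative (\<lambda>s. s *\<^sub>R a)) (at t)"
        by (auto intro!: derivative_eq_intros)
      from has_derivative_compose[OF this has_derivative_gradient[OF test_functionD(2)[OF \<phi>]]]
      have "((\<lambda>s. \<phi> (x + s *\<^sub>R a)) has_real_derivative (gradient \<phi> (x + t *\<^sub>R a) \<bullet> a)) (at t)"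
        unfolding has_field_derivative_def
        by (rule has_derivative_eq_rhs) (simp add: fun_eq_iff)
      then have "(\<lambda>i. (\<phi> (x + (t + h i) *\<^sub>R a) - \<phi> (x + t *\<^sub>R a)) / h i)
          \<longlonglongrightarrow> gradient \<phi> (x + t *\<^sub>R a) \<bullet> a"
        using nz lim unfolding DERIV_def tendsto_at_iff_sequentially o_def by blast
      then show "(\<lambda>i. ?q i x) \<longlonglongrightarrow> f x * (gradient \<phi> (x + t *\<^sub>R a) \<bullet> a)"
        by (rule tendsto_mult_left)
    qed
  qed measurable
  moreover have q_eq: "(LINT x|lborel. ?q i x) = ((LINT x|lborel. f x * \<phi> (x + (t + h i) *\<^sub>R a))
      - (LINT x|lborel. f x * \<phi> (x + t *\<^sub>R a))) / h i" for i
  proof -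
    have "(LINT x|lborel. ?q i x)
        = (LINT x|lborel. (f x * \<phi> (x + (t + h i) *\<^sub>R a) - f x * \<phi> (x + t *\<^sub>R a)) / h i)"
      by (simp add: algebra_simps)
    then show ?thesis
      by (simp add: Bochner_Integration.integral_diff[OF int int])
  qed
  ultimately show "((\<lambda>s. ((LINT x|lborel. f x * \<phi> (x + (t + s) *\<^sub>R a))
      - (LINT x|lborel. f x * \<phi> (x + t *\<^sub>R a))) / s) \<circ> h)
      \<longlonglongrightarrow> (LINT x|lborel. f x * (gradient \<phi> (x + t *\<^sub>R a) \<bullet> a))"
    by (simp only: o_def q_eq)
qed

text \<open>
  The integral of \<open>\<phi>(x + t a)\<close> over the whole space does not depend on \<^term>\<open>t\<close>; its derivative at
  \<open>t = 0\<close> is the integral in question. In the theorem this says that constant fields are divergence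
  free.
\<close>

proposition integral_gradient_eq_0:
  fixes \<phi> :: "real^'n \<Rightarrow> real"
  assumes \<phi>: "\<phi> \<in> test_functions \<Omega>"
  shows "(LINT x|lborel. gradient \<phi> x \<bullet> a) = 0"
proof -
  have "bounded (closure {x. \<phi> x \<noteq> 0})"
    using test_functionD(4)[OF \<phi>] by (rule compact_imp_bounded)
  then obtain r where r: "\<And>x. x \<in> closure {x. \<phi> x \<noteq> 0} \<Longrightarrow> norm x \<le> r"
    by (auto simp: bounded_iff)
  \<comment> \<open>A cutoff that makes the integrand integrable; it equals \<open>1\<close> on the supports of all translates
     with \<open>|t| < 1\<close>.\<close>
  define f where "f = indicat_real (cball (0 :: real^'n) (r + norm a))"
  have f: "integrable lborel f"
    unfolding f_def using emeasure_bounded_finite[of "cball (0 :: real^'n) (r + norm a)"]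
    by (intro integrable_real_indicator) auto
  have [measurable]: "\<phi> \<in> borel_measurable borel"
    by (rule borel_measurable_continuous_onI[OF test_functionD(3)[OF \<phi>]])
  let ?G = "\<lambda>t. LINT x|lborel. f x * \<phi> (x + t *\<^sub>R a)"
  have const: "?G t = (LINT x|lborel. \<phi> x)" if "t \<in> {-1<..<1}" for t
  proof -
    have "f x * \<phi> (x + t *\<^sub>R a) = \<phi> (t *\<^sub>R a + x)" for x
    proof (cases "\<phi> (x + t *\<^sub>R a) = 0")
      case False
      then have "norm (x + t *\<^sub>R a) \<le> r"
        using r closure_subset[of "{x. \<phi> x \<noteq> 0}"] by auto
      moreover have "norm (t *\<^sub>R a) \<le> norm a"
        using that mult_right_mono[of "\<bar>t\<bar>" 1 "norm a"] by (simp add: abs_le_iff)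
      ultimately have "norm x \<le> r + norm a"
        using norm_triangle_ineq4[of "x + t *\<^sub>R a" "t *\<^sub>R a"] by simp
      then show ?thesis by (simp add: f_def add.commute)
    qed (simp add: add.commute)
    then show ?thesis by (simp add: integral_lborel_translate[of \<phi>])
  qed
  have "(?G has_real_derivative 0) (at 0)"
  proof (rule has_field_derivative_transform_within_open[where S = "{-1<..<1}"])
    show "((\<lambda>t. LINT x|lborel. \<phi> x) has_real_derivative 0) (at (0::real))" by simp
  qed (use const in auto)
  then have 0: "(LINT x|lborel. f x * (gradient \<phi> (x + 0 *\<^sub>R a) \<bullet> a)) = 0"
    by (rule DERIV_unique[OF has_derivative_integral_translate[OF \<phi> f]])
  have "f x * (gradient \<phi> (x + 0 *\<^sub>R a) \<bullet> a) = gradient \<phi> x \<bullet> a" for x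
  proof (cases "x \<in> closure {x. \<phi> x \<noteq> 0}")
    case True
    then have "norm x \<le> r + norm a" using r[OF True] norm_ge_zero[of a] by linarith
    then show ?thesis by (simp add: f_def)
  qed (simp add: gradient_eq_0_outside_support)
  with 0 show ?thesis by (simp only:)
qed

text \<open>
  Along the segment from \<^term>\<open>c\<close> to \<^term>\<open>c'\<close> the value of the mollified function has derivative \<open>0\<close>:
  that derivative is the pairing of \<^term>\<open>f\<close> with a derivative of the translated mollifier, which is a
  test function on the larger ball.
\<close>

lemma mollification_constant_on_ball:
  fixes f :: "real^'n \<Rightarrow> real"
  assumes f: "integrable lborel f"
    and flat: "\<And>\<phi> a. \<phi> \<in> test_functions (ball x0 R) \<Longrightarrow>
      (LINT x|lborel. f x * (gradient \<phi> x \<bullet> a)) = 0"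
    and \<epsilon>: "0 < \<epsilon>" "\<epsilon> \<le> R - r" and c: "c \<in> ball x0 r" "c' \<in> ball x0 r"
  shows "(LINT y|lborel. f y * mollifier \<epsilon> (y - c)) = (LINT y|lborel. f y * mollifier \<epsilon> (y - c'))"
proof -
  let ?\<rho> = "mollifier \<epsilon> :: real^'n \<Rightarrow> real"
  note \<rho> = mollifier_test_function_UNIV[OF \<epsilon>(1), where 'a = 'n]
  define G where "G t = (LINT y|lborel. f y * ?\<rho> (y + t *\<^sub>R (c - c') - c))" for t
  have test: "(\<lambda>y. ?\<rho> (y - d)) \<in> test_functions (ball x0 R)" if "d \<in> ball x0 r" for d
  proof (rule mollifier_test_function[OF \<epsilon>(1)])
    show "cball d \<epsilon> \<subseteq> ball x0 R"
    proof
      fix y assume "y \<in> cball d \<epsilon>"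
      then show "y \<in> ball x0 R" using that \<epsilon>(2) dist_triangle[of x0 y d] by auto
    qed
  qed
  have "(G has_real_derivative 0) (at t within {0..1})" if "t \<in> {0..1}" for t
  proof -
    define d where "d = c - t *\<^sub>R (c - c')"
    have "d = (1 - t) *\<^sub>R c + t *\<^sub>R c'" by (simp add: d_def algebra_simps)
    then have d: "d \<in> ball x0 r"
      using convex_ball[of x0 r] c that by (simp add: convex_alt)
    have tr: "y + t *\<^sub>R (c - c') - c = y - d" for y by (simp add: d_def)
    have "gradient (\<lambda>y. ?\<rho> (y - c)) (y + t *\<^sub>R (c - c')) = gradient (\<lambda>y. ?\<rho> (y - d)) y" for y
      unfolding gradient_translate[OF test_functionD(2)[OF \<rho>]] tr ..
    then have "(LINT y|lborel. f y * (gradient (\<lambda>y. ?\<rho> (y - c)) (y + t *\<^sub>R (c - c')) \<bullet> (c - c'))) = 0"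
      using flat[OF test[OF d]] by simp
    then have "((\<lambda>t. LINT y|lborel. f y * ?\<rho> (y + t *\<^sub>R (c - c') - c)) has_real_derivative 0) (at t)"
      using has_derivative_integral_translate[OF test[OF c(1)] f, of "c - c'" t] by simp
    then show ?thesis
      unfolding G_def[abs_def] by (rule has_field_derivative_at_within)
  qed
  then have "\<exists>k. \<forall>t\<in>{0..1}. G t = k"
    by (intro has_field_derivative_zero_constant) auto
  then have "G 0 = G 1" by fastforce
  then show ?thesis by (simp add: G_def)
qed

text \<open>
  Let \<open>b\<close> be the measure of the smaller ball and \<open>a\<close> that of its part in \<^term>\<open>U\<close>. The mollified
  indicator of \<^term>\<open>U\<close> is a constant \<open>C\<close> on the smaller ball. Pairing it with the indicator of the ball
  gives \<open>C b\<close>, pairing it with the indicator of the part in \<^term>\<open>U\<close> gives \<open>C a\<close>, and both tend to \<open>a\<close>.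
  Eliminating \<open>C\<close> leaves \<open>a b = a\<^sup>2\<close>.
\<close>

proposition flat_set_null_or_conull_on_ball:
  fixes U :: "(real^'n) set"
  assumes U [measurable]: "U \<in> sets borel" and fin: "emeasure lborel U < \<infinity>"
    and flat: "\<And>\<phi> a. \<phi> \<in> test_functions (ball x0 R) \<Longrightarrow>
      (LINT x|lborel. indicator U x * (gradient \<phi> x \<bullet> a)) = 0"
    and r: "0 < r" "r < R"
  shows "measure lborel (U \<inter> ball x0 r) = 0 \<or> measure lborel (U \<inter> ball x0 r) = measure lborel (ball x0 r)"
proof -
  let ?B = "ball x0 r"
  define f where "f = indicat_real U"
  define a where "a = measure lborel (U \<inter> ?B)"
  define b where "b = measure lborel ?B"
  have f: "integrable lborel f"
    unfolding f_def using fin by (intro integrable_real_indicator) auto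
  have f_c: "integrable lborel (\<lambda>x. complex_of_real (f x))"
    using f by (rule integrable_of_real)
  have est: "\<exists>C. \<bar>C * b - a\<bar> \<le> e \<and> \<bar>C * a - a\<bar> \<le> e" if "e > 0" for e
  proof -
    let ?app = "\<lambda>S \<epsilon>. norm ((LINT x|lborel. complex_of_real (indicator S x) *
        (LINT y|lborel. of_real (mollifier \<epsilon> (y - x)) * of_real (f y)))
        - (LINT x|lborel. complex_of_real (indicator S x) * of_real (f x))) \<le> e"
    have app: "\<exists>d>0. \<forall>\<epsilon>. 0 < \<epsilon> \<and> \<epsilon> < d \<longrightarrow> ?app S \<epsilon>" if [measurable]: "S \<in> sets borel" for S
      by (rule mollifier_approximate_identity[OF f_c _ _ \<open>e > 0\<close>, where M = 1])
        (auto simp: indicator_def)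
    obtain d1 where "d1 > 0" and d1: "\<And>\<epsilon>. 0 < \<epsilon> \<Longrightarrow> \<epsilon> < d1 \<Longrightarrow> ?app ?B \<epsilon>"
      using app[of ?B] by auto
    obtain d2 where "d2 > 0" and d2: "\<And>\<epsilon>. 0 < \<epsilon> \<Longrightarrow> \<epsilon> < d2 \<Longrightarrow> ?app (U \<inter> ?B) \<epsilon>"
      using app[of "U \<inter> ?B"] by auto
    define \<epsilon> where "\<epsilon> = min (min d1 d2) (R - r) / 2"
    have \<epsilon>: "0 < \<epsilon>" "\<epsilon> < d1" "\<epsilon> < d2" "\<epsilon> \<le> R - r"
      using \<open>d1 > 0\<close> \<open>d2 > 0\<close> r by (auto simp: \<epsilon>_def)
    define C where "C = (LINT y|lborel. f y * mollifier \<epsilon> (y - x0))"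
    have C: "(LINT y|lborel. complex_of_real (mollifier \<epsilon> (y - x)) * of_real (f y)) = of_real C"
      if "x \<in> ?B" for x
    proof -
      have "(LINT y|lborel. f y * mollifier \<epsilon> (y - x)) = C"
        unfolding C_def using flat r that
        by (intro mollification_constant_on_ball[OF f _ \<epsilon>(1,4)]) (auto simp: f_def)
      then show ?thesis
        by (simp add: mult.commute flip: of_real_mult)
    qed
    have lhs: "(LINT x|lborel. complex_of_real (indicator S x) *
        (LINT y|lborel. of_real (mollifier \<epsilon> (y - x)) * of_real (f y)))
        = of_real (C * measure lborel S)" if "S \<in> sets borel" "S \<subseteq> ?B" for S
    proof -
      have "(LINT x|lborel. complex_of_real (indicator S x) *
          (LINT y|lborel. of_real (mollifier \<epsilon> (y - x)) * of_real (f y)))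
          = (LINT x|lborel. complex_of_real (C * indicator S x))"
      proof (rule Bochner_Integration.integral_cong[OF refl])
        show "complex_of_real (indicator S x) *
          (LINT y|lborel. of_real (mollifier \<epsilon> (y - x)) * of_real (f y))
          = complex_of_real (C * indicator S x)" for x
          using C[of x] that(2) by (cases "x \<in> S") auto
      qed
      also have "\<dots> = of_real (LINT x|lborel. C * indicator S x)"
        by (rule integral_complex_of_real)
      also have "(LINT x|lborel. C * indicator S x) = C * measure lborel S"
        using that(1) by simp
      finally show ?thesis .
    qed
    have rhs: "(LINT x|lborel. complex_of_real (indicator S x) * of_real (f x))
        = of_real (measure lborel (U \<inter> S))" if "S \<in> sets borel" for S
    proof -
      have "complex_of_real (indicator S x) * of_real (f x) = of_real (indicat_real (U \<inter> S) x)" for x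
        by (cases "x \<in> U"; cases "x \<in> S") (simp_all add: f_def)
      then have "(LINT x|lborel. complex_of_real (indicator S x) * of_real (f x))
          = (LINT x|lborel. complex_of_real (indicat_real (U \<inter> S) x))" by simp
      also have "\<dots> = of_real (LINT x|lborel. indicat_real (U \<inter> S) x)"
        by (rule integral_complex_of_real)
      finally show ?thesis using that by simp
    qed
    have "\<bar>C * b - a\<bar> \<le> e"
      using d1[OF \<epsilon>(1,2)] lhs[of ?B] rhs[of ?B]
      by (simp add: a_def b_def del: of_real_mult of_real_diff flip: of_real_diff)
    moreover have "\<bar>C * a - a\<bar> \<le> e"
      using d2[OF \<epsilon>(1,3)] lhs[of "U \<inter> ?B"] rhs[of "U \<inter> ?B"]
      by (simp add: a_def Int_left_absorb del: of_real_mult of_real_diff flip: of_real_diff)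
    ultimately show ?thesis by blast
  qed
  have ab: "0 \<le> a" "0 \<le> b" by (auto simp: a_def b_def)
  have bound: "\<bar>a * b - a * a\<bar> \<le> e * (a + b)" if "e > 0" for e
  proof -
    obtain C where C: "\<bar>C * b - a\<bar> \<le> e" "\<bar>C * a - a\<bar> \<le> e" using est[OF \<open>e > 0\<close>] by blast
    have "a * b - a * a = a * (C * b - a) - b * (C * a - a)" by (simp add: algebra_simps)
    also have "\<bar>\<dots>\<bar> \<le> \<bar>a * (C * b - a)\<bar> + \<bar>b * (C * a - a)\<bar>" by (rule abs_triangle_ineq4)
    also have "\<dots> \<le> a * e + b * e"
      unfolding abs_mult using C ab by (intro add_mono mult_mono) auto
    finally show ?thesis by (simp add: algebra_simps)
  qed
  have "\<bar>a * b - a * a\<bar> \<le> 0 + e" if "e > 0" for e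
  proof -
    have "\<bar>a * b - a * a\<bar> \<le> e / (a + b + 1) * (a + b)"
      using bound[of "e / (a + b + 1)"] that ab by simp
    also have "\<dots> \<le> e" using that ab by (simp add: field_simps)
    finally show ?thesis by simp
  qed
  then have "\<bar>a * b - a * a\<bar> \<le> 0" by (rule field_le_epsilon)
  then have "a * (b - a) = 0" by (simp add: algebra_simps)
  then show ?thesis by (auto simp: a_def b_def)
qed

section \<open>Reduction to a square system\<close>

text \<open>
  Vectors are chosen one after the other. The next one must avoid, for each \<^term>\<open>A\<close>, the preimage of the
  span of the images chosen so far. By surjectivity each preimage is a proper subspace as long as
  fewer than \<open>n\<close> vectors have been chosen, and finitely many proper subspaces, being null sets,
  do not cover the space.
\<close>

lemma common_independent_images:
  fixes \<A> :: "(real^'m^'n) set"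
  assumes fin: "finite \<A>" and surj: "\<And>A. A \<in> \<A> \<Longrightarrow> surj ((*v) A)"
  shows "\<exists>w :: 'n \<Rightarrow> real^'m. \<forall>A\<in>\<A>. \<forall>c. (\<Sum>j\<in>J. c j *\<^sub>R (A *v w j)) = 0 \<longrightarrow> (\<forall>j\<in>J. c j = 0)"
  using finite[of J]
proof (induction J rule: finite_induct)
  case (insert k J)
  then obtain w where w: "\<And>A c. A \<in> \<A> \<Longrightarrow> (\<Sum>j\<in>J. c j *\<^sub>R (A *v w j)) = 0 \<Longrightarrow> \<forall>j\<in>J. c j = 0"
    by blast
  define W :: "real^'m^'n \<Rightarrow> (real^'m) set" where "W A = {x. A *v x \<in> span ((\<lambda>j. A *v w j) ` J)}" for A
  have neg: "negligible (W A)" if "A \<in> \<A>" for A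
  proof (rule negligible_lowdim)
    have "subspace (W A)"
      using linear_subspace_vimage[OF matrix_vector_mul_linear subspace_span]
      by (simp add: W_def vimage_def)
    moreover have "W A \<noteq> UNIV"
    proof
      assume "W A = UNIV"
      have "y \<in> span ((\<lambda>j. A *v w j) ` J)" for y
      proof -
        obtain x where "y = A *v x" using surj[OF \<open>A \<in> \<A>\<close>] by (metis surjD)
        moreover have "x \<in> W A" using \<open>W A = UNIV\<close> by simp
        ultimately show ?thesis by (simp add: W_def)
      qed
      then have "(UNIV :: (real^'n) set) \<subseteq> span ((\<lambda>j. A *v w j) ` J)" by blast
      then have "dim (UNIV :: (real^'n) set) \<le> card ((\<lambda>j. A *v w j) ` J)"
        by (intro dim_le_card) auto
      also have "\<dots> \<le> card J" by (rule card_image_le) simp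
      also have "\<dots> < CARD('n)" using insert.hyps by (intro psubset_card_mono) auto
      finally show False by simp
    qed
    ultimately show "dim (W A) < DIM(real^'m)"
      by (metis dim_eq_full dim_subset_UNIV le_neq_implies_less span_eq_iff)
  qed
  have "negligible (\<Union>A\<in>\<A>. W A)"
    using fin neg by (intro negligible_Union) auto
  then have "(\<Union>A\<in>\<A>. W A) \<noteq> UNIV"
    using non_negligible_UNIV by metis
  then obtain x where x: "\<And>A. A \<in> \<A> \<Longrightarrow> A *v x \<notin> span ((\<lambda>j. A *v w j) ` J)"
    unfolding W_def by blast
  show ?case
  proof (intro exI[of _ "w(k := x)"] ballI allI impI)
    fix A c j
    assume A: "A \<in> \<A>" and "j \<in> insert k J"
      and "(\<Sum>j\<in>insert k J. c j *\<^sub>R (A *v (w(k := x)) j)) = 0"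
    moreover have "(\<Sum>j\<in>J. c j *\<^sub>R (A *v (w(k := x)) j)) = (\<Sum>j\<in>J. c j *\<^sub>R (A *v w j))"
      using insert.hyps by (intro sum.cong) auto
    ultimately have 0: "c k *\<^sub>R (A *v x) + (\<Sum>j\<in>J. c j *\<^sub>R (A *v w j)) = 0"
      using insert.hyps by simp
    have "c k = 0"
    proof (rule ccontr)
      assume "c k \<noteq> 0"
      have "c k *\<^sub>R (A *v x) = - (\<Sum>j\<in>J. c j *\<^sub>R (A *v w j))"
        using 0 by (simp add: eq_neg_iff_add_eq_0)
      also have "\<dots> \<in> span ((\<lambda>j. A *v w j) ` J)"
        by (intro span_neg span_sum span_scale) (auto intro: span_base)
      finally have "(1 / c k) *\<^sub>R (c k *\<^sub>R (A *v x)) \<in> span ((\<lambda>j. A *v w j) ` J)"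
        by (rule span_scale)
      then show False using x[OF A] \<open>c k \<noteq> 0\<close> by simp
    qed
    then show "c j = 0" using 0 w[OF A, of c] \<open>j \<in> insert k J\<close> by auto
  qed
qed simp

text \<open>
  The columns of \<open>S\<close> are vectors whose images under every \<^term>\<open>A\<close> form a basis.
\<close>

proposition common_square_reduction:
  fixes \<A> :: "(real^'m^'n) set"
  assumes "finite \<A>" "\<And>A. A \<in> \<A> \<Longrightarrow> surj ((*v) A)"
  shows "\<exists>S :: real^'n^'m. \<forall>A\<in>\<A>. invertible (A ** S)"
proof -
  obtain w :: "'n \<Rightarrow> real^'m"
    where w: "\<And>A c. A \<in> \<A> \<Longrightarrow> (\<Sum>j\<in>UNIV. c j *\<^sub>R (A *v w j)) = 0 \<Longrightarrow> \<forall>j. c j = 0"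
    using common_independent_images[OF assms, of UNIV] by auto
  define S :: "real^'n^'m" where "S = (\<chi> i j. w j $ i)"
  have "invertible (A ** S)" if "A \<in> \<A>" for A
  proof -
    have "column j (A ** S) = A *v w j" for j
      by (simp add: vec_eq_iff column_def matrix_matrix_mult_def matrix_vector_mult_def S_def)
    then have "\<exists>B. B ** (A ** S) = mat 1"
      unfolding matrix_left_invertible_independent_columns
      using w[OF that] by (simp add: scalar_mult_eq_scaleR)
    then show ?thesis by (simp add: invertible_left_inverse)
  qed
  then show ?thesis by blast
qed

text \<open>
  With \<open>S\<close> from the previous result, normalised to \<open>P\<^sup>T S = 1\<close>, take \<open>T = Q\<^sup>T S\<close> and multiply the
  rectangular system by \<open>S\<^sup>T\<close>. The ranks of \<^term>\<open>Q\<close> and of \<^term>\<open>P - Q\<close> exclude the eigenvalues \<open>0\<close> and \<open>1\<close>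
  of \<^term>\<open>T\<close>, as \<open>1 - T = (P - Q)\<^sup>T S\<close>.
\<close>

lemma reduction_to_square:
  fixes P Q :: "real^'n^'m"
  assumes "rank P = CARD('n)" "rank Q = CARD('n)" "rank (P - Q) = CARD('n)"
  obtains T :: "real^'n^'n" where
    "\<And>p q. P *v p + Q *v q = 0 \<Longrightarrow> p + transpose T *v q = 0"
    "\<And>x. T *v x = 0 \<Longrightarrow> x = 0" "\<And>x. T *v x = x \<Longrightarrow> x = 0"
proof -
  let ?\<A> = "{transpose P, transpose Q, transpose (P - Q)}"
  have "surj ((*v) A)" if "A \<in> ?\<A>" for A
    using that assms by (auto simp: full_rank_surjective[symmetric] rank_transpose)
  then obtain S0 :: "real^'n^'m" where S0: "\<And>A. A \<in> ?\<A> \<Longrightarrow> invertible (A ** S0)"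
    using common_square_reduction[of ?\<A>] by auto
  obtain N where N: "(transpose P ** S0) ** N = mat 1" "N ** (transpose P ** S0) = mat 1"
    using S0[of "transpose P"] by (auto simp: invertible_def)
  define S where "S = S0 ** N"
  define T where "T = transpose Q ** S"
  have PS: "transpose P ** S = mat 1" using N by (simp add: S_def matrix_mul_assoc)
  have inj: "x = 0" if A: "A \<in> ?\<A>" "(A ** S) *v x = 0" for A x
  proof -
    obtain L where L: "L ** (A ** S0) = mat 1" using S0[OF A(1)] by (auto simp: invertible_def)
    have "(A ** S0) *v (N *v x) = 0"
      using A(2) by (simp add: S_def matrix_vector_mul_assoc matrix_mul_assoc)
    then have "(L ** (A ** S0)) *v (N *v x) = 0" by (simp flip: matrix_vector_mul_assoc)
    then have "N *v x = 0" by (simp add: L)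
    then have "((transpose P ** S0) ** N) *v x = 0" by (simp flip: matrix_vector_mul_assoc)
    then show "x = 0" by (simp add: N)
  qed
  show thesis
  proof (rule that[of T])
    fix p q assume "P *v p + Q *v q = 0"
    then have "transpose S *v (P *v p + Q *v q) = 0" by simp
    then have "transpose (transpose P ** S) *v p + transpose T *v q = 0"
      by (simp add: T_def matrix_transpose_mul matrix_vector_mul_assoc matrix_vector_right_distrib)
    then show "p + transpose T *v q = 0" by (simp add: PS transpose_mat)
  next
    show "T *v x = 0 \<Longrightarrow> x = 0" for x using inj[of "transpose Q" x] by (simp add: T_def)
    fix x assume "T *v x = x"
    then have "(transpose P ** S) *v x - (transpose Q ** S) *v x = 0" by (simp add: PS T_def)
    moreover have "transpose (P - Q) = transpose P - transpose Q"
      by (simp add: transpose_def vec_eq_iff)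
    ultimately have "(transpose (P - Q) ** S) *v x = 0"
      by (simp add: matrix_vector_mult_diff_rdistrib flip: matrix_vector_mul_assoc)
    then show "x = 0" using inj[of "transpose (P - Q)" x] by simp
  qed
qed

text \<open>
  Real and imaginary parts of an eigenvector to a real eigenvalue are real eigenvectors or zero.
\<close>

lemma complexification_fixes_only_0:
  fixes T :: "real^'n^'n" and z :: "complex^'n" and c :: real
  assumes T: "\<And>x. T *v x = c *\<^sub>R x \<Longrightarrow> x = 0"
    and z: "(\<chi> i j. complex_of_real (T $ i $ j)) *v z = of_real c *s z"
  shows "z = 0"
proof -
  have eq: "(\<Sum>j\<in>UNIV. complex_of_real (T $ i $ j) * z $ j) = of_real c * z $ i" for i
    using z by (simp add: vec_eq_iff matrix_vector_mult_def)
  have "T *v (\<chi> i. Re (z $ i)) = c *\<^sub>R (\<chi> i. Re (z $ i))"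
    using arg_cong[OF eq, of Re] by (simp add: vec_eq_iff matrix_vector_mult_def)
  then have "(\<chi> i. Re (z $ i)) = 0" by (rule T)
  moreover have "T *v (\<chi> i. Im (z $ i)) = c *\<^sub>R (\<chi> i. Im (z $ i))"
    using arg_cong[OF eq, of Im] by (simp add: vec_eq_iff matrix_vector_mult_def)
  then have "(\<chi> i. Im (z $ i)) = 0" by (rule T)
  ultimately show "z = 0" by (simp add: vec_eq_iff complex_eq_iff)
qed

section \<open>The divergence equation in terms of the phases\<close>

lemma integrable_gradient:
  fixes \<phi> :: "real^'n \<Rightarrow> real"
  assumes \<phi>: "\<phi> \<in> test_functions \<Omega>" and S [measurable]: "S \<in> sets borel"
  shows "integrable lborel (\<lambda>x. indicator S x *\<^sub>R gradient \<phi> x)"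
proof -
  let ?K = "closure {x. \<phi> x \<noteq> 0}"
  have [measurable]: "gradient \<phi> \<in> borel_measurable borel"
    by (rule borel_measurable_continuous_onI[OF continuous_on_gradient[OF \<phi>]])
  obtain M where M: "0 \<le> M" "\<And>x. norm (gradient \<phi> x) \<le> M" using gradient_bounded[OF \<phi>] by blast
  have fin: "emeasure lborel ?K < \<infinity>"
    using test_functionD(4)[OF \<phi>] by (intro emeasure_bounded_finite compact_imp_bounded)
  show ?thesis
  proof (rule Bochner_Integration.integrable_bound)
    show "integrable lborel (\<lambda>x. M * indicat_real ?K x)"
      using fin by (intro integrable_mult_right integrable_real_indicator) auto
    show "AE x in lborel. norm (indicator S x *\<^sub>R gradient \<phi> x) \<le> norm (M * indicat_real ?K x)"
    proof (rule AE_I2)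
      fix x
      show "norm (indicator S x *\<^sub>R gradient \<phi> x) \<le> norm (M * indicat_real ?K x)"
        using M gradient_eq_0_outside_support[of x \<phi>]
        by (cases "x \<in> ?K"; cases "x \<in> S") simp_all
    qed
  qed measurable
qed

text \<open>
  This is \<open>Div B = 0\<close> for \<open>B = A3 + 1\<^sub>U (A1 - A3) + 1\<^sub>V (A2 - A3)\<close>, all rows at once, with the constant
  field \<^term>\<open>A3\<close> dropped. The sets are Borel so that product measures can be used later on.
\<close>

lemma phase_equation:
  fixes \<Omega> :: "(real^'n) set" and A1 A2 A3 :: "real^'n^'m"
  assumes \<Omega>: "open \<Omega>" and U: "U \<in> sets borel" and V: "V \<in> sets borel"
    and B: "B \<in> borel_measurable (lebesgue_on \<Omega>)"
    and ae: "AE x in lebesgue_on \<Omega>.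
      B x = A3 + indicat_real U x *\<^sub>R (A1 - A3) + indicat_real V x *\<^sub>R (A2 - A3)"
    and div: "distr_Div_zero \<Omega> B" and \<phi>: "\<phi> \<in> test_functions \<Omega>"
  shows "(A1 - A3) *v (LINT x|lborel. indicator U x *\<^sub>R gradient \<phi> x)
    + (A2 - A3) *v (LINT x|lborel. indicator V x *\<^sub>R gradient \<phi> x) = 0"
    (is "_ *v ?p + _ *v ?q = 0")
proof -
  have grad: "gradient \<phi> \<in> borel_measurable borel"
    by (rule borel_measurable_continuous_onI[OF continuous_on_gradient[OF \<phi>]])
  have "row i (A1 - A3) \<bullet> ?p + row i (A2 - A3) \<bullet> ?q = 0" for i
  proof -
    define h where "h x = gradient \<phi> x \<bullet> row i A3
      + (indicator U x *\<^sub>R gradient \<phi> x) \<bullet> row i (A1 - A3)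
      + (indicator V x *\<^sub>R gradient \<phi> x) \<bullet> row i (A2 - A3)" for x
    have h_meas: "h \<in> borel_measurable borel"
      unfolding h_def[abs_def] using grad U V by measurable
    have "(LINT x|lebesgue_on \<Omega>. h x) = (LINT x|lebesgue_on \<Omega>. row i (B x) \<bullet> gradient \<phi> x)"
    proof (rule integral_cong_AE)
      show "h \<in> borel_measurable (lebesgue_on \<Omega>)"
        using h_meas by (intro measurable_restrict_space1 measurable_completion) simp
      have "continuous_on UNIV (row i :: real^'n^'m \<Rightarrow> real^'n)"
        unfolding row_def by (intro continuous_intros)
      then have "(\<lambda>x. row i (B x)) \<in> borel_measurable (lebesgue_on \<Omega>)"
        by (rule measurable_compose[OF B borel_measurable_continuous_onI])
      moreover have "gradient \<phi> \<in> borel_measurable (lebesgue_on \<Omega>)"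
        using grad by (intro measurable_restrict_space1 measurable_completion) simp
      ultimately show "(\<lambda>x. row i (B x) \<bullet> gradient \<phi> x) \<in> borel_measurable (lebesgue_on \<Omega>)"
        by (rule borel_measurable_inner)
      have row: "row i (X + s *\<^sub>R Y + t *\<^sub>R Z) = row i X + s *\<^sub>R row i Y + t *\<^sub>R row i Z"
        for X Y Z :: "real^'n^'m" and s t
        by (simp add: row_def vec_eq_iff)
      show "AE x in lebesgue_on \<Omega>. h x = row i (B x) \<bullet> gradient \<phi> x"
        using ae by eventually_elim
          (simp add: h_def row inner_add_left inner_add_right inner_commute[of "gradient \<phi> _"])
    qed
    also have "\<dots> = 0" using div \<phi> by (simp add: distr_Div_zero_def)
    also have "(LINT x|lebesgue_on \<Omega>. h x) = (LINT x|lebesgue. indicator \<Omega> x *\<^sub>R h x)"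
      using \<Omega> by (intro integral_restrict_space) auto
    also have "\<dots> = (LINT x|lebesgue. h x)"
    proof (rule Bochner_Integration.integral_cong[OF refl])
      fix x
      have "gradient \<phi> x = 0" if "x \<notin> \<Omega>"
        using that test_functionD(5)[OF \<phi>] by (intro gradient_eq_0_outside_support) blast
      then show "indicator \<Omega> x *\<^sub>R h x = h x"
        by (cases "x \<in> \<Omega>") (auto simp: h_def)
    qed
    also have "\<dots> = (LINT x|lborel. h x)"
      using h_meas by (intro integral_completion) simp
    also have "\<dots> = (LINT x|lborel. gradient \<phi> x \<bullet> row i A3)
        + (LINT x|lborel. (indicator U x *\<^sub>R gradient \<phi> x) \<bullet> row i (A1 - A3))
        + (LINT x|lborel. (indicator V x *\<^sub>R gradient \<phi> x) \<bullet> row i (A2 - A3))"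
    proof -
      have "integrable lborel (gradient \<phi>)" using integrable_gradient[OF \<phi>, of UNIV] by simp
      then have 0: "integrable lborel (\<lambda>x. gradient \<phi> x \<bullet> row i A3)" by (rule integrable_inner_left)
      have 1: "integrable lborel (\<lambda>x. (indicat_real U x *\<^sub>R gradient \<phi> x) \<bullet> row i (A1 - A3))"
        by (rule integrable_inner_left[OF integrable_gradient[OF \<phi> U]])
      have 2: "integrable lborel (\<lambda>x. (indicat_real V x *\<^sub>R gradient \<phi> x) \<bullet> row i (A2 - A3))"
        by (rule integrable_inner_left[OF integrable_gradient[OF \<phi> V]])
      show ?thesis
        unfolding h_def Bochner_Integration.integral_add[OF Bochner_Integration.integrable_add[OF 0 1] 2]
          Bochner_Integration.integral_add[OF 0 1] ..
    qed
    also have "\<dots> = ?p \<bullet> row i (A1 - A3) + ?q \<bullet> row i (A2 - A3)"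
      by (simp only: integral_gradient_eq_0[OF \<phi>] add_0_left integral_inner_left
          integrable_gradient[OF \<phi> U] integrable_gradient[OF \<phi> V])
    finally show ?thesis by (simp add: inner_commute)
  qed
  then show ?thesis
    by (simp add: vec_eq_iff matrix_vector_mult_def row_def inner_vec_def)
qed

lemma integral_cderiv_indicator:
  fixes \<phi> :: "real^'n \<Rightarrow> real"
  assumes \<phi>: "\<phi> \<in> test_functions \<Omega>" and S: "S \<in> sets borel"
  shows "(LINT x|lborel. cderiv z \<phi> x * indicator S x)
    = (\<Sum>j\<in>UNIV. z $ j * of_real ((LINT x|lborel. indicator S x *\<^sub>R gradient \<phi> x) $ j))"
proof -
  note int = integrable_gradient[OF \<phi> S]
  have comp: "integrable lborel (\<lambda>x. (indicator S x *\<^sub>R gradient \<phi> x) $ j)" for j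
    by (rule integrable_bounded_linear[OF bounded_linear_vec_nth int])
  have "(LINT x|lborel. cderiv z \<phi> x * indicator S x)
      = (LINT x|lborel. (\<Sum>j\<in>UNIV. z $ j * of_real ((indicator S x *\<^sub>R gradient \<phi> x) $ j)))"
    by (rule Bochner_Integration.integral_cong[OF refl])
      (simp add: cderiv_def indicator_def split: split_of_bool)
  also have "\<dots> = (\<Sum>j\<in>UNIV. (LINT x|lborel. z $ j * of_real ((indicator S x *\<^sub>R gradient \<phi> x) $ j)))"
    by (intro Bochner_Integration.integral_sum integrable_mult_right integrable_of_real comp)
  also have "\<dots> = (\<Sum>j\<in>UNIV. z $ j * of_real (LINT x|lborel. (indicator S x *\<^sub>R gradient \<phi> x) $ j))"
    by (simp only: integral_mult_right_zero integral_complex_of_real)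
  also have "\<dots> = (\<Sum>j\<in>UNIV. z $ j * of_real ((LINT x|lborel. indicator S x *\<^sub>R gradient \<phi> x) $ j))"
    by (simp only: integral_bounded_linear[OF bounded_linear_vec_nth int])
  finally show ?thesis .
qed

lemma integrable_indicator_Int_bounded:
  assumes "S \<in> sets borel" "open D" "bounded D"
  shows "integrable lborel (indicator (S \<inter> D) :: 'a::euclidean_space \<Rightarrow> complex)"
proof -
  have "emeasure lborel (S \<inter> D) < \<infinity>"
    by (intro emeasure_bounded_finite bounded_subset[OF assms(3)]) simp
  then have "integrable lborel (\<lambda>x. complex_of_real (indicat_real (S \<inter> D) x))"
    using assms(1,2) by (intro integrable_of_real integrable_real_indicator) simp_all
  then show ?thesis by (simp add: of_real_indicator)
qed

text \<open>
  The matrix \<^term>\<open>T\<close> of the square system, read over the complex numbers, is the one to which the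
  two-phase argument applies: transposing it moves it from the averaged gradients to the
  directions of differentiation.
\<close>

proposition phases_weak_cderiv_zero:
  fixes D U V :: "(real^'n) set" and P Q :: "real^'n^'m"
  assumes D: "open D" "bounded D"
    and ranks: "rank P = CARD('n)" "rank Q = CARD('n)" "rank (P - Q) = CARD('n)"
    and U: "U \<in> sets borel" and V: "V \<in> sets borel" and disj: "U \<inter> V = {}"
    and eq: "\<And>\<phi>. \<phi> \<in> test_functions D \<Longrightarrow>
      P *v (LINT x|lborel. indicator U x *\<^sub>R gradient \<phi> x)
      + Q *v (LINT x|lborel. indicator V x *\<^sub>R gradient \<phi> x) = 0"
  shows "weak_cderiv_zero D z (indicator (U \<inter> D)) \<and> weak_cderiv_zero D z (indicator (V \<inter> D))"
proof -
  obtain T :: "real^'n^'n" where T_eq: "\<And>p q. P *v p + Q *v q = 0 \<Longrightarrow> p + transpose T *v q = 0"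
    and T: "\<And>x. T *v x = 0 \<Longrightarrow> x = 0" "\<And>x. T *v x = x \<Longrightarrow> x = 0"
    by (rule reduction_to_square[OF ranks]) (rule that)
  define TC where "TC = (\<chi> i j. complex_of_real (T $ i $ j))"
  show ?thesis
  proof (rule weak_cderiv_zero_two_phases[where T = TC])
    show "integrable lborel (indicator (U \<inter> D) :: real^'n \<Rightarrow> complex)"
      "integrable lborel (indicator (V \<inter> D) :: real^'n \<Rightarrow> complex)"
      by (rule integrable_indicator_Int_bounded[OF _ D]; fact)+
    show "indicator (U \<inter> D) y * indicator (V \<inter> D) y = (0 :: complex)" for y
      using disj by (auto simp: disjoint_iff indicator_def)
    show "z = 0" if z: "TC *v z = 0" for z
    proof (rule complexification_fixes_only_0[where T = T and c = 0])
      show "x = 0" if "T *v x = 0 *\<^sub>R x" for x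
        by (rule T(1)) (use that in \<open>simp only: scaleR_zero_left\<close>)
      show "(\<chi> i j. complex_of_real (T $ i $ j)) *v z = of_real 0 *s z"
        using z by (simp add: TC_def)
    qed
    show "z = 0" if z: "TC *v z = z" for z
    proof (rule complexification_fixes_only_0[where T = T and c = 1])
      show "x = 0" if "T *v x = 1 *\<^sub>R x" for x
        by (rule T(2)) (use that in \<open>simp only: scaleR_one\<close>)
      show "(\<chi> i j. complex_of_real (T $ i $ j)) *v z = of_real 1 *s z"
        using z by (simp add: TC_def)
    qed
    fix z \<phi> assume \<phi>: "\<phi> \<in> test_functions D"
    define p where "p = (LINT x|lborel. indicator U x *\<^sub>R gradient \<phi> x)"
    define q where "q = (LINT x|lborel. indicator V x *\<^sub>R gradient \<phi> x)"
    have "p + transpose T *v q = 0"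
      unfolding p_def q_def by (rule T_eq[OF eq[OF \<phi>]])
    then have pq: "p $ k = - (\<Sum>j\<in>UNIV. T $ j $ k * q $ j)" for k
      by (simp add: vec_eq_iff matrix_vector_mult_def transpose_def eq_neg_iff_add_eq_0)
    have loc_int: "(LINT x|lborel. cderiv w \<phi> x * indicator (S \<inter> D) x)
        = (\<Sum>j\<in>UNIV. w $ j * of_real ((LINT x|lborel. indicator S x *\<^sub>R gradient \<phi> x) $ j))"
      if S: "S \<in> sets borel" for S w
    proof -
      have "cderiv w \<phi> x * indicator (S \<inter> D) x = cderiv w \<phi> x * indicator S x" for x
      proof (cases "x \<in> D")
        case False
        then have "gradient \<phi> x = 0"
          using test_functionD(5)[OF \<phi>] by (intro gradient_eq_0_outside_support) blast
        then show ?thesis by (simp add: cderiv_def)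
      qed (simp add: indicator_def)
      then show ?thesis using integral_cderiv_indicator[OF \<phi> S, of w] by (simp only:)
    qed
    have "(\<Sum>j\<in>UNIV. (TC *v z) $ j * of_real (q $ j))
        = (\<Sum>j\<in>UNIV. \<Sum>k\<in>UNIV. z $ k * of_real (T $ j $ k * q $ j))"
      by (simp add: TC_def matrix_vector_mult_def sum_distrib_left ac_simps)
    also have "\<dots> = (\<Sum>k\<in>UNIV. \<Sum>j\<in>UNIV. z $ k * of_real (T $ j $ k * q $ j))"
      by (rule sum.swap)
    also have "\<dots> = - (\<Sum>k\<in>UNIV. z $ k * of_real (p $ k))"
      by (simp add: pq sum_distrib_left sum_negf)
    finally show "(LINT x|lborel. cderiv z \<phi> x * indicator (U \<inter> D) x)
        + (LINT x|lborel. cderiv (TC *v z) \<phi> x * indicator (V \<inter> D) x) = 0"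
      unfolding loc_int[OF U] loc_int[OF V] p_def[symmetric] q_def[symmetric] by simp
  qed (simp_all add: indicator_def D)
qed

section \<open>From local to global constancy\<close>

text \<open>
  Directions with real coordinates are among the complex ones.
\<close>

lemma weak_cderiv_zero_imp_gradient:
  fixes \<Omega> :: "(real^'n) set"
  assumes weak: "\<And>z. weak_cderiv_zero \<Omega> z (indicator S)" and \<phi>: "\<phi> \<in> test_functions \<Omega>"
  shows "(LINT x|lborel. indicator S x * (gradient \<phi> x \<bullet> a)) = 0"
proof -
  have eq: "cderiv (\<chi> j. of_real (a $ j)) \<phi> x * indicator S x
      = of_real (indicator S x * (gradient \<phi> x \<bullet> a))" for x
    by (simp add: cderiv_def inner_vec_def indicator_def mult.commute)
  have "of_real (LINT x|lborel. indicator S x * (gradient \<phi> x \<bullet> a))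
      = (LINT x|lborel. complex_of_real (indicator S x * (gradient \<phi> x \<bullet> a)))"
    by (rule integral_complex_of_real[symmetric])
  also have "\<dots> = (LINT x|lborel. cderiv (\<chi> j. of_real (a $ j)) \<phi> x * indicator S x)"
    by (simp only: eq)
  also have "\<dots> = 0"
    using weak[of "\<chi> j. of_real (a $ j)"] \<phi> unfolding weak_cderiv_zero_def by blast
  finally show ?thesis by simp
qed

lemma negligible_of_measure_0:
  fixes S :: "'a::euclidean_space set"
  assumes "S \<in> sets borel" "bounded S" "measure lborel S = 0"
  shows "negligible S"
proof -
  have "S \<in> lmeasurable" using assms(1,2) by (intro bounded_set_imp_lmeasurable) auto
  then show ?thesis using assms by (simp add: negligible_iff_measure)
qed

text \<open>
  Passing to a Borel subset, rather than to a Borel set that is merely almost equal, keeps disjoint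
  sets disjoint.
\<close>

lemma lebesgue_borel_subset:
  fixes E :: "'a::euclidean_space set"
  assumes "E \<in> sets lebesgue"
  obtains U where "U \<in> sets borel" "U \<subseteq> E" "negligible (E - U)"
proof -
  obtain U N N' where "E = U \<union> N" "N \<subseteq> N'" "N' \<in> null_sets lborel" "U \<in> sets lborel"
    using sets_completionE[OF assms] .
  moreover have "negligible N'"
    using \<open>N' \<in> null_sets lborel\<close> by (simp add: negligible_iff_null_sets null_sets_completionI)
  ultimately show thesis
    by (intro that[of U]) (auto intro: negligible_subset)
qed

lemma negligible_or_conegligible_on_ball:
  fixes S :: "(real^'n) set"
  assumes S: "S \<in> sets borel" and r: "0 < r" "r < R"
    and flat: "\<And>z. weak_cderiv_zero (ball x R) z (indicator (S \<inter> ball x R))"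
  shows "negligible (S \<inter> ball x r) \<or> negligible (ball x r - S)"
proof -
  let ?D = "ball x R" and ?B = "ball x r"
  have "?B \<subseteq> ?D" using r by (intro subset_ball) simp
  then have cap: "S \<inter> ?D \<inter> ?B = S \<inter> ?B" by blast
  have "measure lborel (S \<inter> ?D \<inter> ?B) = 0 \<or> measure lborel (S \<inter> ?D \<inter> ?B) = measure lborel ?B"
  proof (rule flat_set_null_or_conull_on_ball[where R = R])
    show "S \<inter> ?D \<in> sets borel" using S by simp
    show "emeasure lborel (S \<inter> ?D) < \<infinity>"
      by (intro emeasure_bounded_finite bounded_subset[OF bounded_ball[of x R]]) simp
    show "(LINT y|lborel. indicator (S \<inter> ?D) y * (gradient \<phi> y \<bullet> a)) = 0"
      if "\<phi> \<in> test_functions ?D" for \<phi> a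
      by (rule weak_cderiv_zero_imp_gradient[OF flat that])
  qed (use r in auto)
  then consider "measure lborel (S \<inter> ?B) = 0" | "measure lborel (S \<inter> ?B) = measure lborel ?B"
    unfolding cap by blast
  then show ?thesis
  proof cases
    case 1
    have "negligible (S \<inter> ?B)"
      by (rule negligible_of_measure_0) (use S 1 in \<open>auto intro: bounded_subset[OF bounded_ball[of x r]]\<close>)
    then show ?thesis ..
  next
    case 2
    have fin: "emeasure lborel ?B \<noteq> \<infinity>" using emeasure_bounded_finite[of ?B] by simp
    have "?B - S = ?B - S \<inter> ?B" by blast
    then have "measure lborel (?B - S) = measure lborel ?B - measure lborel (S \<inter> ?B)"
      using measure_Diff[of lborel ?B "S \<inter> ?B"] S fin by simp
    then have "measure lborel (?B - S) = 0" using 2 by simp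
    then have "negligible (?B - S)"
      by (intro negligible_of_measure_0) (use S in \<open>auto intro: bounded_subset[OF bounded_ball[of x r]]\<close>)
    then show ?thesis ..
  qed
qed

text \<open>
  The local constants form a locally constant function: where two of the balls overlap, they overlap
  in a nonempty open set, which is too large to be covered by the two exceptional null sets. The
  exceptional sets then combine, since being negligible is a local property.
\<close>

proposition locally_ae_constant_imp_ae_constant:
  fixes f :: "'a::euclidean_space \<Rightarrow> 'b"
  assumes "connected \<Omega>" "\<Omega> \<noteq> {}"
    and loc: "\<And>x. x \<in> \<Omega> \<Longrightarrow> \<exists>r>0. \<exists>C\<in>K. ball x r \<subseteq> \<Omega> \<and> negligible {y \<in> ball x r. f y \<noteq> C}"
  shows "\<exists>C\<in>K. negligible {x \<in> \<Omega>. f x \<noteq> C}"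
proof -
  obtain r c where rc: "\<And>x. x \<in> \<Omega> \<Longrightarrow> r x > 0 \<and> c x \<in> K \<and> ball x (r x) \<subseteq> \<Omega> \<and>
      negligible {y \<in> ball x (r x). f y \<noteq> c x}"
    using loc by metis
  have same: "c x = c y" if "x \<in> \<Omega>" "y \<in> \<Omega>" "y \<in> ball x (r x)" for x y
  proof (rule ccontr)
    assume "c x \<noteq> c y"
    let ?O = "ball x (r x) \<inter> ball y (r y)"
    have "?O \<subseteq> {z \<in> ball x (r x). f z \<noteq> c x} \<union> {z \<in> ball y (r y). f z \<noteq> c y}"
      using \<open>c x \<noteq> c y\<close> by auto
    then have "negligible ?O"
      using rc that by (meson negligible_Un negligible_subset)
    moreover have "y \<in> ?O" "open ?O" using rc that by auto
    ultimately show False using open_not_negligible by blast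
  qed
  obtain x0 where "x0 \<in> \<Omega>" using assms(2) by blast
  have const: "c x = c x0" if "x \<in> \<Omega>" for x
  proof (rule connected_local_const[OF assms(1) that \<open>x0 \<in> \<Omega>\<close>], rule ballI)
    fix y assume "y \<in> \<Omega>"
    then show "\<forall>\<^sub>F z in at y within \<Omega>. c y = c z"
      using same[of y] rc[of y] unfolding eventually_at
      by (intro exI[of _ "r y"]) (auto simp: dist_commute)
  qed
  let ?N = "{x \<in> \<Omega>. f x \<noteq> c x0}"
  have "negligible ?N"
    unfolding locally_negligible_alt[of ?N]
  proof
    fix x assume x: "x \<in> ?N"
    have "negligible (?N \<inter> ball x (r x))"
      by (rule negligible_subset[of "{y \<in> ball x (r x). f y \<noteq> c x}"])
        (use rc[of x] const[of x] x in auto)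
    moreover have "openin (top_of_set ?N) (?N \<inter> ball x (r x))"
      by (rule openin_open_Int) simp
    moreover have "x \<in> ?N \<inter> ball x (r x)" using x rc[of x] by auto
    ultimately show "\<exists>U. openin (top_of_set ?N) U \<and> x \<in> U \<and> negligible U" by blast
  qed
  then show ?thesis using rc \<open>x0 \<in> \<Omega>\<close> by blast
qed

section \<open>Three divergence free phases\<close>

theorem theorem1p7:
  fixes \<Omega> :: "(real^'n) set"
    and A :: "nat \<Rightarrow> real^'n^'m"
    and K :: "(real^'n^'m) set"
    and B :: "real^'n \<Rightarrow> real^'n^'m"
  assumes "CARD('n) \<le> CARD('m)"
    and "open \<Omega>" and "connected \<Omega>"
    and "K = {A 1, A 2, A 3}"
    and "\<And>i j. i \<in> {1, 2, 3} \<Longrightarrow> j \<in> {1, 2, 3} \<Longrightarrow> i \<noteq> j \<Longrightarrow> rank (A i - A j) = CARD('n)"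
    and "B \<in> borel_measurable (lebesgue_on \<Omega>)"
    and "\<And>x. x \<in> \<Omega> \<Longrightarrow> B x \<in> K"
    and "distr_Div_zero \<Omega> B"
  shows "\<exists>C\<in>K. AE x in lebesgue_on \<Omega>. B x = C"
proof (cases "\<Omega> = {}")
  case True
  then show ?thesis using assms(4) by (auto intro!: AE_I2)
next
  case False
  define P where "P = A 1 - A 3"
  define Q where "Q = A 2 - A 3"
  have ranks: "rank P = CARD('n)" "rank Q = CARD('n)" "rank (P - Q) = CARD('n)"
    using assms(5)[of 1 3] assms(5)[of 2 3] assms(5)[of 1 2] by (simp_all add: P_def Q_def)
  have neq: "A 1 \<noteq> A 2"
    using assms(5)[of 1 2] by (auto simp: rank_0)
  have level: "{x \<in> \<Omega>. B x = C} \<in> sets lebesgue" for C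
  proof -
    have "B -` {C} \<inter> space (lebesgue_on \<Omega>) \<in> sets (lebesgue_on \<Omega>)"
      by (rule measurable_sets[OF assms(6)]) simp
    moreover have "B -` {C} \<inter> space (lebesgue_on \<Omega>) = {x \<in> \<Omega>. B x = C}" by auto
    ultimately show ?thesis using assms(2) by (auto simp: sets_restrict_space_iff)
  qed
  obtain U where U: "U \<in> sets borel" "U \<subseteq> {x \<in> \<Omega>. B x = A 1}" "negligible ({x \<in> \<Omega>. B x = A 1} - U)"
    using lebesgue_borel_subset[OF level] .
  obtain V where V: "V \<in> sets borel" "V \<subseteq> {x \<in> \<Omega>. B x = A 2}" "negligible ({x \<in> \<Omega>. B x = A 2} - V)"
    using lebesgue_borel_subset[OF level] .
  have UB: "B x = A 1" if "x \<in> U" for x using subsetD[OF U(2) that] by simp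
  have VB: "B x = A 2" if "x \<in> V" for x using subsetD[OF V(2) that] by simp
  have disj: "U \<inter> V = {}"
  proof (rule equals0I)
    fix x assume "x \<in> U \<inter> V"
    then show False using UB[of x] VB[of x] neq by simp
  qed
  have disjD: "x \<notin> V" if "x \<in> U" for x using disj that by blast
  define N where "N = ({x \<in> \<Omega>. B x = A 1} - U) \<union> ({x \<in> \<Omega>. B x = A 2} - V)"
  have N: "negligible N" unfolding N_def using U(3) V(3) by (rule negligible_Un)
  \<comment> \<open>The null set \<open>N\<close> collects the points that the Borel sets miss.\<close>
  have third: "B x = A 3" if "x \<in> \<Omega>" "x \<notin> N" "x \<notin> U" "x \<notin> V" for x
  proof -
    have "B x \<noteq> A 1" "B x \<noteq> A 2" using that unfolding N_def by blast+
    then show ?thesis using assms(4) assms(7)[OF that(1)] by simp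
  qed
  have AE_off: "AE x in lebesgue_on \<Omega>. x \<notin> N'" if "negligible N'" for N'
  proof -
    have "AE x in lebesgue. x \<notin> N'"
      using that by (simp add: negligible_iff_null_sets AE_not_in)
    then show ?thesis using assms(2) by (subst AE_restrict_space_iff) (auto elim: eventually_mono)
  qed
  have ae: "AE x in lebesgue_on \<Omega>.
      B x = A 3 + indicat_real U x *\<^sub>R (A 1 - A 3) + indicat_real V x *\<^sub>R (A 2 - A 3)"
    using AE_off[OF N] AE_space
  proof eventually_elim
    case (elim x)
    then have "x \<in> \<Omega>" by simp
    then show ?case using third[OF _ elim(1)] UB[of x] VB[of x] disjD[of x]
      by (cases "x \<in> U"; cases "x \<in> V") simp_all
  qed

  \<comment> \<open>On half of a ball contained in \<open>\<Omega>\<close> each of \<open>U\<close>, \<open>V\<close> has either null or full measure.\<close>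
  have loc: "\<exists>r>0. \<exists>C\<in>K. ball x r \<subseteq> \<Omega> \<and> negligible {y \<in> ball x r. B y \<noteq> C}" if x: "x \<in> \<Omega>" for x
  proof -
    obtain R where "R > 0" and R: "ball x R \<subseteq> \<Omega>" by (rule openE[OF assms(2) x])
    let ?D' = "ball x (R / 2)"
    have flat: "weak_cderiv_zero (ball x R) z (indicator (U \<inter> ball x R))
        \<and> weak_cderiv_zero (ball x R) z (indicator (V \<inter> ball x R))" for z
    proof (rule phases_weak_cderiv_zero[OF open_ball bounded_ball ranks U(1) V(1) disj])
      fix \<phi> assume "\<phi> \<in> test_functions (ball x R)"
      then have "\<phi> \<in> test_functions \<Omega>" by (rule subsetD[OF test_functions_mono[OF R]])
      then show "P *v (LINT x|lborel. indicator U x *\<^sub>R gradient \<phi> x)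
          + Q *v (LINT x|lborel. indicator V x *\<^sub>R gradient \<phi> x) = 0"
        unfolding P_def Q_def
        by (rule phase_equation[OF assms(2) U(1) V(1) assms(6) ae assms(8)])
    qed
    have half: "0 < R / 2" "R / 2 < R" using \<open>R > 0\<close> by simp_all
    note dichotomy = negligible_or_conegligible_on_ball[OF _ half]
    have sub: "?D' \<subseteq> \<Omega>" using R \<open>R > 0\<close> by auto
    consider "negligible (?D' - U)" | "negligible (?D' - V)"
      | "negligible (U \<inter> ?D')" "negligible (V \<inter> ?D')"
      using dichotomy[OF U(1) conjunct1[OF flat]] dichotomy[OF V(1) conjunct2[OF flat]] by blast
    then have "\<exists>C\<in>K. negligible {y \<in> ?D'. B y \<noteq> C}"
    proof cases
      case 1
      then have "negligible {y \<in> ?D'. B y \<noteq> A 1}" by (rule negligible_subset) (use UB in blast)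
      then show ?thesis using assms(4) by blast
    next
      case 2
      then have "negligible {y \<in> ?D'. B y \<noteq> A 2}" by (rule negligible_subset) (use VB in blast)
      then show ?thesis using assms(4) by blast
    next
      case 3
      then have "negligible (U \<inter> ?D' \<union> V \<inter> ?D' \<union> N)" using N by (intro negligible_Un)
      then have "negligible {y \<in> ?D'. B y \<noteq> A 3}"
        by (rule negligible_subset) (use third sub in blast)
      then show ?thesis using assms(4) by blast
    qed
    then show ?thesis using sub \<open>R > 0\<close> by (intro exI[of _ "R / 2"]) auto
  qed
  obtain C where "C \<in> K" and C: "negligible {x \<in> \<Omega>. B x \<noteq> C}"
    using locally_ae_constant_imp_ae_constant[OF assms(3) False loc] by blast
  have "AE x in lebesgue_on \<Omega>. B x = C"
    using AE_off[OF C] AE_space by eventually_elim auto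
  with \<open>C \<in> K\<close> show ?thesis by blast
qed

end
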